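(* Let $F$ be a fragment of $L_{\omega_1\omega}(L)$ for a countable signature $L$, and let $1\le\alpha<\omega_1$. Suppose $A\subseteq\mathrm{Mod}(L)$ and $A\in\boldsymbol{\Pi}^0_{1+\alpha}(t_F)$. Then for every $\bar a\in\mathbb N^{<\mathbb N}$ and $u\in\mathbb Q^+$ there exists an $\alpha$-AE family $P(\bar x)$ (with respect to $F$) such that $$A^{*\bar a,u}=\{N\in\mathrm{Mod}(L):\ \bar a\text{ realizes }P(\bar x)\text{ in }N\}.$$
   Context: Continuous logic setting. A signature $L$ is a countable set of predicate symbols $P_0=d,P_1,\dots$, each with an arity, a modulus of continuity and a compact bound interval; metric structures are complete metric spaces interpreting the predicates respecting moduli and bounds. Distance of tuples $\bar a\in M^m,\bar b\in M^n$: $d(\bar a,\bar b)=\max\{d(a_i,b_i):i<\min(m,n)\}$ (also for infinite sequences). Formulas of $L_{\omega_1\omega}(L)$ are built from atomic formulas using $\phi+\psi$, $r\phi$ ($r\in\mathbb Q$), $\max$, the constant $1$, $\sup_x,\inf_x$, and countable suprema/infima of formulas with the same finite set of free variables respecting a common modulus and bound. A fragment is a countable set of formulas containing the atomic ones and closed under finitary connectives, quantifiers, subformulas and substitution of terms for variables. $\mathrm{Mod}(L)$ is the Polish space of separable complete metric $L$-structures $M$ with a distinguished tail-dense sequence $(a_i)_{i\in\mathbb N}$ (a sequence every tail of which is dense), coded by $P_i^M(a_{j_0},\dots)$; elements of $\mathbb N^{<\mathbb N}$ denote tuples of distinguished elements. $t_F$ is the topology on $\mathrm{Mod}(L)$ generated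 by $\{M:\phi^M(\bar a)<r\}$, $\phi\in F$, $\bar a\in\mathbb N^{<\mathbb N}$, $r\in\mathbb Q$. Vaught transforms: for $M\in\mathrm{Mod}(L)$ let $D(M)\subseteq M^{\mathbb N}$ be the Polish space of tail-dense sequences in $M$, and $\pi:D(M)\to\mathrm{Mod}(L)$ send $y$ to the code of $M$ with distinguished sequence $y$. For $A\subseteq\mathrm{Mod}(L)$, $\bar a\in\mathbb N^{<\mathbb N}$, $u\in\mathbb Q^+$: $M\in A^{*\bar a,u}$ iff for comeager many $y$ in $\{y\in D(M):d(y,\bar a)<u\}$, $\pi(y)\in A$. AE families (w.r.t. $F$): a $(-1)$-AE family $P(\bar x)$ is a formula $\phi(\bar x)\in F$. If $\beta=0$ or $\beta$ is a limit ordinal, a $\beta$-AE family $P(\bar x)$ is a countable collection of $\gamma$-AE families $p_k(\bar x)$ with $\gamma<\beta$; a $(\beta+1)$-AE family is a collection $\{p_{k,l}(\bar x_{k,l})\}_{k,l\in\mathbb N}$ of $\gamma$-AE families with $\gamma<\beta$ and $\bar x\subseteq\bar x_{k,l}$; for $2\le n<\omega$, a $(\beta+n)$-AE family is a collection $\{p_{k,l}(\bar x_{k,l})\}_{k,l}$ of $(\beta+n-2)$-AE families with $\bar x\subseteq\bar x_{k,l}$. Each $\alpha$-AE family $P=\{p_{k,l}\}$ with $\alpha\ge1$ comes with a fixed $u_P\ge0$ with $u_P\ge u_{p_{k,l}}$ for all $k,l$. Realization: $\bar a$ in $M$ realizes a $(-1)$-family $\phi(\bar x)$ if $\phi^M(\bar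 a)=0$; realizes a $\beta$-family ($\beta=0$ or limit) if it realizes each member; realizes a $(\beta+n)$-family $\{p_{k,l}(\bar x_{k,l})\}$, $1\le n<\omega$, if for every finite tuple $\bar b$ in $M$ with $d(\bar b,\bar a)<u_P$, every $v>0$ and every $k$ there exist a finite tuple $\bar c$ in $M$ with $d(\bar c,\bar b)<v$ and $l$ such that $\bar c$ realizes $p_{k,l}(\bar x_{k,l})$ in $M$. $M$ models $P$ if the empty tuple realizes $P(\emptyset)$ in $M$. *)

theory Defs
  imports "HOL-Analysis.Analysis" "HOL-Library.Countable_Set_Type"
begin

section \<open>Countable ordinals\<close>

text \<open>The ordinals below \<open>\<omega>\<^sub>1\<close>: the carrier of the cardinal successor of \<open>\<omega>\<close>.\<close>

typedef omega1 = "Field (cardSuc natLeq)"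
proof -
  have "infinite (Field (cardSuc natLeq))"
    using cardSuc_finite[OF natLeq_Card_order] by (simp add: Field_natLeq)
  then show ?thesis by (metis ex_in_conv finite.emptyI)
qed

lemma cardSuc_natLeq_Well_order: "Well_order (cardSuc natLeq)"
  using cardSuc_Card_order[OF natLeq_Card_order] by (simp add: card_order_on_def)

instantiation omega1 :: wellorder
begin

definition less_eq_omega1 :: "omega1 \<Rightarrow> omega1 \<Rightarrow> bool" where
  "less_eq_omega1 x y \<longleftrightarrow> (Rep_omega1 x, Rep_omega1 y) \<in> cardSuc natLeq"

definition less_omega1 :: "omega1 \<Rightarrow> omega1 \<Rightarrow> bool" where
  "less_omega1 x y \<longleftrightarrow> x \<le> y \<and> x \<noteq> y"

instance
proof
  have wo: "Refl (cardSuc natLeq)" "trans (cardSuc natLeq)" "antisym (cardSuc natLeq)"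
    "Total (cardSuc natLeq)" "wf (cardSuc natLeq - Id)"
    using cardSuc_natLeq_Well_order
    by (simp_all add: well_order_on_def linear_order_on_def partial_order_on_def preorder_on_def)
  show refl: "x \<le> x" for x :: omega1
    unfolding less_eq_omega1_def by (rule refl_onD[OF wo(1) Rep_omega1])
  show antisym: "x = y" if "x \<le> y" "y \<le> x" for x y :: omega1
    using antisymD[OF wo(3), of "Rep_omega1 x" "Rep_omega1 y"] that
    by (simp add: less_eq_omega1_def Rep_omega1_inject)
  show "x < y \<longleftrightarrow> x \<le> y \<and> \<not> y \<le> x" for x y :: omega1
    using antisym[of x y] refl by (auto simp: less_omega1_def)
  show "x \<le> z" if "x \<le> y" "y \<le> z" for x y z :: omega1
    using that unfolding less_eq_omega1_def by (rule transD[OF wo(2)])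
  show "x \<le> y \<or> y \<le> x" for x y :: omega1
  proof (cases "x = y")
    case True
    then show ?thesis using refl by simp
  next
    case False
    then have "Rep_omega1 x \<noteq> Rep_omega1 y" by (simp add: Rep_omega1_inject)
    then show ?thesis unfolding less_eq_omega1_def
      by (rule wo(4)[unfolded total_on_def, rule_format, OF Rep_omega1 Rep_omega1])
  qed
  show "P a" if IH: "\<And>x. (\<And>y. y < x \<Longrightarrow> P y) \<Longrightarrow> P x" for P and a :: omega1
  proof -
    have "wf (inv_image (cardSuc natLeq - Id) Rep_omega1)"
      by (rule wf_inv_image[OF wo(5)])
    then show ?thesis
    proof (induction a rule: wf_induct_rule)
      case (less x)
      show ?case
        by (rule IH, rule less) (auto simp: less_omega1_def less_eq_omega1_def Rep_omega1_inject)
    qed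
  qed
qed

end

text \<open>The next two facts determine \<open>omega1\<close> up to order isomorphism.\<close>

lemma countable_lessThan_omega1:
  includes cardinal_syntax
  shows "countable {..<\<alpha> :: omega1}"
proof -
  have "Rep_omega1 ` {..<\<alpha>} \<subseteq> underS (cardSuc natLeq) (Rep_omega1 \<alpha>)"
    by (auto simp: underS_def less_omega1_def less_eq_omega1_def Rep_omega1_inject)
  moreover have "|underS (cardSuc natLeq) (Rep_omega1 \<alpha>)| <o cardSuc natLeq"
    by (intro card_of_underS cardSuc_Card_order natLeq_Card_order Rep_omega1)
  then have "countable (underS (cardSuc natLeq) (Rep_omega1 \<alpha>))"
    unfolding countable_card_le_natLeq
    by (rule iffD1[OF cardSuc_ordLeq_ordLess[OF natLeq_Card_order card_of_Card_order]])
  ultimately have "countable (Rep_omega1 ` {..<\<alpha>})"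
    using countable_subset by blast
  then show ?thesis
    by (rule countable_image_inj_on) (auto simp: inj_on_def Rep_omega1_inject)
qed

lemma uncountable_omega1:
  includes cardinal_syntax
  shows "uncountable (UNIV :: omega1 set)"
proof
  assume "countable (UNIV :: omega1 set)"
  then have "countable (range Rep_omega1)" by simp
  moreover have "range Rep_omega1 = Field (cardSuc natLeq)"
    using type_definition.Rep_range[OF type_definition_omega1] .
  ultimately have "|Field (cardSuc natLeq)| \<le>o natLeq"
    by (simp add: countable_card_le_natLeq)
  then have "cardSuc natLeq \<le>o natLeq"
    by (rule ordIso_ordLeq_trans[OF ordIso_symmetric
          [OF card_of_Field_ordIso[OF cardSuc_Card_order[OF natLeq_Card_order]]]])
  then show False
    using not_ordLess_ordLeq[OF cardSuc_greater[OF natLeq_Card_order]] by contradiction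
qed

text \<open>Hence the least elements in the definitions of addition and successor exist.\<close>

lemma countable_bounded_omega1:
  assumes "countable (S :: omega1 set)"
  shows "\<exists>\<beta>. \<forall>\<alpha>\<in>S. \<alpha> < \<beta>"
proof (rule ccontr)
  assume "\<not> ?thesis"
  then have *: "UNIV = (\<Union>\<alpha>\<in>S. {..\<alpha>})" by (auto simp: not_less)
  have "{..\<alpha>} = insert \<alpha> {..<\<alpha>}" for \<alpha> :: omega1 by auto
  then have "countable {..\<alpha>}" for \<alpha> :: omega1
    using countable_lessThan_omega1 by simp
  then have "countable (UNIV :: omega1 set)"
    unfolding * using assms by (intro countable_UN)
  then show False using uncountable_omega1 by simp
qed

text \<open>\<open>\<alpha> + \<beta>\<close> is the least ordinal that is \<open>\<ge> \<alpha>\<close> and above every \<open>\<alpha> + \<gamma>\<close> with \<open>\<gamma> < \<beta>\<close>.\<close>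

function oadd :: "omega1 \<Rightarrow> omega1 \<Rightarrow> omega1" where
  "oadd \<alpha> \<beta> = (LEAST \<xi>. \<alpha> \<le> \<xi> \<and> (\<forall>\<gamma>. \<gamma> < \<beta> \<longrightarrow> oadd \<alpha> \<gamma> < \<xi>))"
  by auto
termination
  by (relation "inv_image {(x, y). x < y} snd") (auto intro: wf)

declare oadd.simps [simp del]

definition osuc :: "omega1 \<Rightarrow> omega1" where
  "osuc \<alpha> = (LEAST \<xi>. \<alpha> < \<xi>)"

instantiation omega1 :: "{zero, plus}"
begin

definition zero_omega1 :: omega1 where "zero_omega1 = (LEAST \<xi>. True)"
definition plus_omega1 :: "omega1 \<Rightarrow> omega1 \<Rightarrow> omega1" where "plus_omega1 = oadd"

instance ..

end

instantiation omega1 :: one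
begin

definition one_omega1 :: omega1 where "one_omega1 = osuc 0"

instance ..

end

definition is_limit :: "omega1 \<Rightarrow> bool" where
  "is_limit \<beta> \<longleftrightarrow> \<beta> \<noteq> 0 \<and> (\<forall>\<gamma><\<beta>. osuc \<gamma> < \<beta>)"


section \<open>Borel classes and Baire category\<close>

inductive Sigma0 :: "'a topology \<Rightarrow> omega1 \<Rightarrow> 'a set \<Rightarrow> bool"
  and Pi0 :: "'a topology \<Rightarrow> omega1 \<Rightarrow> 'a set \<Rightarrow> bool"
  for X :: "'a topology" where
  open_Sigma0: "openin X U \<Longrightarrow> Sigma0 X 1 U"
| Union_Sigma0: "1 < \<xi> \<Longrightarrow> (\<forall>n::nat. 1 \<le> \<zeta> n \<and> \<zeta> n < \<xi> \<and> Pi0 X (\<zeta> n) (A n)) \<Longrightarrow>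
    Sigma0 X \<xi> (\<Union>n. A n)"
| compl_Pi0: "Sigma0 X \<xi> U \<Longrightarrow> Pi0 X \<xi> (topspace X - U)"

definition nowhere_dense_in :: "'a topology \<Rightarrow> 'a set \<Rightarrow> bool" where
  "nowhere_dense_in X S \<longleftrightarrow> S \<subseteq> topspace X \<and> X interior_of (X closure_of S) = {}"

definition meager_in :: "'a topology \<Rightarrow> 'a set \<Rightarrow> bool" where
  "meager_in X S \<longleftrightarrow> (\<exists>\<N>. countable \<N> \<and> (\<forall>T\<in>\<N>. nowhere_dense_in X T) \<and> S = \<Union>\<N>)"

definition comeager_in :: "'a topology \<Rightarrow> 'a set \<Rightarrow> bool" where
  "comeager_in X S \<longleftrightarrow> S \<subseteq> topspace X \<and> meager_in X (topspace X - S)"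


section \<open>Signatures and metric structures\<close>

text \<open>A modulus is applied to the maximum distance of two argument tuples.\<close>

definition is_modulus :: "(real \<Rightarrow> real) \<Rightarrow> bool" where
  "is_modulus \<Delta> \<longleftrightarrow> \<Delta> 0 = 0 \<and> continuous_on {0..} \<Delta> \<and>
     (\<forall>r\<ge>0. \<forall>s\<ge>0. \<Delta> r \<le> \<Delta> (r + s) \<and> \<Delta> (r + s) \<le> \<Delta> r + \<Delta> s)"

text \<open>The predicate symbols are indexed by a set of natural numbers; \<open>0\<close> is the metric \<open>d\<close>.\<close>

record signature =
  syms :: "nat set"
  arity :: "nat \<Rightarrow> nat"
  modulus :: "nat \<Rightarrow> real \<Rightarrow> real"
  lower :: "nat \<Rightarrow> real"
  upper :: "nat \<Rightarrow> real"

definition is_signature :: "signature \<Rightarrow> bool" where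
  "is_signature L \<longleftrightarrow> 0 \<in> syms L \<and> arity L 0 = 2 \<and>
     (\<forall>i\<in>syms L. is_modulus (modulus L i) \<and> lower L i \<le> upper L i)"

record 'a mstruct =
  carr :: "'a set"
  interp :: "nat \<Rightarrow> 'a list \<Rightarrow> real"

text \<open>Set to \<open>0\<close> off the carrier because the locale \<^locale>\<open>Metric_space\<close> asks for nonnegativity
  and symmetry on the whole type.\<close>

definition sdist :: "'a mstruct \<Rightarrow> 'a \<Rightarrow> 'a \<Rightarrow> real" where
  "sdist M x y = (if x \<in> carr M \<and> y \<in> carr M then interp M 0 [x, y] else 0)"

text \<open>Only the common initial part of two tuples counts; the empty maximum is \<open>0\<close>.\<close>

definition tdist :: "'a mstruct \<Rightarrow> 'a list \<Rightarrow> 'a list \<Rightarrow> real" where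
  "tdist M xs ys =
     Max (insert 0 {sdist M (xs ! i) (ys ! i) | i. i < min (length xs) (length ys)})"

definition is_structure :: "signature \<Rightarrow> 'a mstruct \<Rightarrow> bool" where
  "is_structure L M \<longleftrightarrow>
     Metric_space (carr M) (sdist M) \<and> Metric_space.mcomplete (carr M) (sdist M) \<and>
     (\<forall>i\<in>syms L. \<forall>xs\<in>lists (carr M). length xs = arity L i \<longrightarrow>
        lower L i \<le> interp M i xs \<and> interp M i xs \<le> upper L i \<and>
        (\<forall>ys\<in>lists (carr M). length ys = arity L i \<longrightarrow>
           \<bar>interp M i xs - interp M i ys\<bar> \<le> modulus L i (tdist M xs ys)))"


section \<open>Infinitary formulas\<close>

text \<open>Variables are de Bruijn indices, so that formulas are identified up to renaming of bound
  variables and substitution avoids capture: \<open>Var_sup\<close> and \<open>Var_inf\<close> bind index \<open>0\<close>, and index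
  \<open>Suc i\<close> below the quantifier is the free variable \<open>x\<^sub>i\<close> of the quantified formula.\<close>

datatype fm =
    Atom nat "nat list"
  | Unit
  | Plus fm fm
  | Scale rat fm
  | Maxi fm fm
  | Var_sup fm
  | Var_inf fm
  | Count_sup "nat \<Rightarrow> fm"
  | Count_inf "nat \<Rightarrow> fm"

primrec fv :: "fm \<Rightarrow> nat set" where
  "fv (Atom i xs) = set xs"
| "fv Unit = {}"
| "fv (Plus \<phi> \<psi>) = fv \<phi> \<union> fv \<psi>"
| "fv (Scale r \<phi>) = fv \<phi>"
| "fv (Maxi \<phi> \<psi>) = fv \<phi> \<union> fv \<psi>"
| "fv (Var_sup \<phi>) = {i. Suc i \<in> fv \<phi>}"
| "fv (Var_inf \<phi>) = {i. Suc i \<in> fv \<phi>}"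
| "fv (Count_sup f) = (\<Union>n. fv (f n))"
| "fv (Count_inf f) = (\<Union>n. fv (f n))"

primrec subst :: "fm \<Rightarrow> (nat \<Rightarrow> nat) \<Rightarrow> fm" where
  "subst (Atom i xs) = (\<lambda>\<sigma>. Atom i (map \<sigma> xs))"
| "subst Unit = (\<lambda>\<sigma>. Unit)"
| "subst (Plus \<phi> \<psi>) = (\<lambda>\<sigma>. Plus (subst \<phi> \<sigma>) (subst \<psi> \<sigma>))"
| "subst (Scale r \<phi>) = (\<lambda>\<sigma>. Scale r (subst \<phi> \<sigma>))"
| "subst (Maxi \<phi> \<psi>) = (\<lambda>\<sigma>. Maxi (subst \<phi> \<sigma>) (subst \<psi> \<sigma>))"
| "subst (Var_sup \<phi>) = (\<lambda>\<sigma>. Var_sup (subst \<phi> (case_nat 0 (\<lambda>i. Suc (\<sigma> i)))))"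
| "subst (Var_inf \<phi>) = (\<lambda>\<sigma>. Var_inf (subst \<phi> (case_nat 0 (\<lambda>i. Suc (\<sigma> i)))))"
| "subst (Count_sup f) = (\<lambda>\<sigma>. Count_sup (\<lambda>n. subst (f n) \<sigma>))"
| "subst (Count_inf f) = (\<lambda>\<sigma>. Count_inf (\<lambda>n. subst (f n) \<sigma>))"

primrec eval :: "'a mstruct \<Rightarrow> fm \<Rightarrow> (nat \<Rightarrow> 'a) \<Rightarrow> real" where
  "eval M (Atom i xs) = (\<lambda>e. interp M i (map e xs))"
| "eval M Unit = (\<lambda>e. 1)"
| "eval M (Plus \<phi> \<psi>) = (\<lambda>e. eval M \<phi> e + eval M \<psi> e)"
| "eval M (Scale r \<phi>) = (\<lambda>e. of_rat r * eval M \<phi> e)"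
| "eval M (Maxi \<phi> \<psi>) = (\<lambda>e. max (eval M \<phi> e) (eval M \<psi> e))"
| "eval M (Var_sup \<phi>) = (\<lambda>e. SUP x\<in>carr M. eval M \<phi> (case_nat x e))"
| "eval M (Var_inf \<phi>) = (\<lambda>e. INF x\<in>carr M. eval M \<phi> (case_nat x e))"
| "eval M (Count_sup f) = (\<lambda>e. SUP n. eval M (f n) e)"
| "eval M (Count_inf f) = (\<lambda>e. INF n. eval M (f n) e)"

text \<open>Structures are taken with carrier a subset of \<^typ>\<open>real\<close>, which plays no role other than
  as a set of size continuum: every separable metric space is isometric to one whose points lie in
  this type.  By the downward Loewenheim-Skolem theorem, separable structures suffice for testing
  whether a formula respects a modulus and a bound.\<close>

definition fm_respects :: "signature \<Rightarrow> fm \<Rightarrow> (real \<Rightarrow> real) \<Rightarrow> real \<Rightarrow> real \<Rightarrow> bool" where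
  "fm_respects L \<phi> \<Delta> lo hi \<longleftrightarrow>
     (\<forall>M::real mstruct. is_structure L M \<longrightarrow>
        (\<forall>e. range e \<subseteq> carr M \<longrightarrow> lo \<le> eval M \<phi> e \<and> eval M \<phi> e \<le> hi \<and>
           (\<forall>e'. range e' \<subseteq> carr M \<longrightarrow>
              \<bar>eval M \<phi> e - eval M \<phi> e'\<bar>
                \<le> \<Delta> (Max (insert 0 ((\<lambda>i. sdist M (e i) (e' i)) ` fv \<phi>))))))"

definition combinable :: "signature \<Rightarrow> (nat \<Rightarrow> fm) \<Rightarrow> bool" where
  "combinable L f \<longleftrightarrow>
     (\<exists>X. finite X \<and> (\<forall>n. fv (f n) = X)) \<and>
     (\<exists>\<Delta> lo hi. is_modulus \<Delta> \<and> (\<forall>n. fm_respects L (f n) \<Delta> lo hi))"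

inductive_set formulas :: "signature \<Rightarrow> fm set" for L :: signature where
  "i \<in> syms L \<Longrightarrow> length xs = arity L i \<Longrightarrow> Atom i xs \<in> formulas L"
| "Unit \<in> formulas L"
| "\<phi> \<in> formulas L \<Longrightarrow> \<psi> \<in> formulas L \<Longrightarrow> Plus \<phi> \<psi> \<in> formulas L"
| "\<phi> \<in> formulas L \<Longrightarrow> Scale r \<phi> \<in> formulas L"
| "\<phi> \<in> formulas L \<Longrightarrow> \<psi> \<in> formulas L \<Longrightarrow> Maxi \<phi> \<psi> \<in> formulas L"
| "\<phi> \<in> formulas L \<Longrightarrow> Var_sup \<phi> \<in> formulas L"
| "\<phi> \<in> formulas L \<Longrightarrow> Var_inf \<phi> \<in> formulas L"
| "(\<And>n. f n \<in> formulas L) \<Longrightarrow> combinable L f \<Longrightarrow> Count_sup f \<in> formulas L"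
| "(\<And>n. f n \<in> formulas L) \<Longrightarrow> combinable L f \<Longrightarrow> Count_inf f \<in> formulas L"

primrec imm_subformulas :: "fm \<Rightarrow> fm set" where
  "imm_subformulas (Atom i xs) = {}"
| "imm_subformulas Unit = {}"
| "imm_subformulas (Plus \<phi> \<psi>) = {\<phi>, \<psi>}"
| "imm_subformulas (Scale r \<phi>) = {\<phi>}"
| "imm_subformulas (Maxi \<phi> \<psi>) = {\<phi>, \<psi>}"
| "imm_subformulas (Var_sup \<phi>) = {\<phi>}"
| "imm_subformulas (Var_inf \<phi>) = {\<phi>}"
| "imm_subformulas (Count_sup f) = range f"
| "imm_subformulas (Count_inf f) = range f"

text \<open>The only terms are variables.  Quantification over any other variable than the one bound by
  \<open>Var_sup\<close> and \<open>Var_inf\<close> is covered by closure under substitution.\<close>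

definition is_fragment :: "signature \<Rightarrow> fm set \<Rightarrow> bool" where
  "is_fragment L F \<longleftrightarrow>
     countable F \<and> F \<subseteq> formulas L \<and>
     (\<forall>i xs. i \<in> syms L \<and> length xs = arity L i \<longrightarrow> Atom i xs \<in> F) \<and>
     Unit \<in> F \<and>
     (\<forall>\<phi>\<in>F. \<forall>\<psi>\<in>F. Plus \<phi> \<psi> \<in> F \<and> Maxi \<phi> \<psi> \<in> F) \<and>
     (\<forall>\<phi>\<in>F. \<forall>r. Scale r \<phi> \<in> F) \<and>
     (\<forall>\<phi>\<in>F. Var_sup \<phi> \<in> F \<and> Var_inf \<phi> \<in> F) \<and>
     (\<forall>\<phi>\<in>F. imm_subformulas \<phi> \<subseteq> F) \<and>
     (\<forall>\<phi>\<in>F. \<forall>\<sigma>. subst \<phi> \<sigma> \<in> F)"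

text \<open>\<open>\<phi>\<^sup>M(xs)\<close>, where \<open>x\<^sub>i\<close> is the \<open>i\<close>-th entry of \<open>xs\<close>; used only if \<open>fv \<phi> \<subseteq> {..<length xs}\<close>.\<close>

definition evalt :: "'a mstruct \<Rightarrow> fm \<Rightarrow> 'a list \<Rightarrow> real" where
  "evalt M \<phi> xs = eval M \<phi> (\<lambda>i. xs ! i)"


section \<open>The space of coded structures\<close>

text \<open>The set \<open>D(M)\<close> of sequences in \<open>M\<close> all of whose tails are dense, and the Polish topology on it.\<close>

definition tail_dense :: "'a mstruct \<Rightarrow> (nat \<Rightarrow> 'a) set" where
  "tail_dense M = {y. range y \<subseteq> carr M \<and>
     (\<forall>n. Metric_space.mtopology (carr M) (sdist M) closure_of (y ` {n..}) = carr M)}"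

definition tail_dense_topology :: "'a mstruct \<Rightarrow> (nat \<Rightarrow> 'a) topology" where
  "tail_dense_topology M = subtopology
     (product_topology (\<lambda>_. Metric_space.mtopology (carr M) (sdist M)) UNIV) (tail_dense M)"

text \<open>The code of \<open>M\<close> with distinguished sequence \<open>y\<close>; for fixed \<open>M\<close> this is the map \<open>\<pi>\<close>.\<close>

type_synonym code = "nat \<Rightarrow> nat list \<Rightarrow> real"

definition code_of :: "signature \<Rightarrow> 'a mstruct \<Rightarrow> (nat \<Rightarrow> 'a) \<Rightarrow> code" where
  "code_of L M y =
     (\<lambda>i js. if i \<in> syms L \<and> length js = arity L i then interp M i (map y js) else 0)"

definition presents :: "signature \<Rightarrow> real mstruct \<times> (nat \<Rightarrow> real) \<Rightarrow> code \<Rightarrow> bool" where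
  "presents L Ma N \<longleftrightarrow>
     is_structure L (fst Ma) \<and> snd Ma \<in> tail_dense (fst Ma) \<and> code_of L (fst Ma) (snd Ma) = N"

definition Mod :: "signature \<Rightarrow> code set" where
  "Mod L = {N. \<exists>Ma. presents L Ma N}"

text \<open>A structure with distinguished sequence having code \<open>N\<close>.  It is unique up to a unique
  isomorphism preserving the distinguished sequence.\<close>

definition pres :: "signature \<Rightarrow> code \<Rightarrow> real mstruct \<times> (nat \<Rightarrow> real)" where
  "pres L N = (SOME Ma. presents L Ma N)"

definition str :: "signature \<Rightarrow> code \<Rightarrow> real mstruct" where
  "str L N = fst (pres L N)"

definition pts :: "signature \<Rightarrow> code \<Rightarrow> nat list \<Rightarrow> real list" where
  "pts L N js = map (snd (pres L N)) js"

definition t_top :: "signature \<Rightarrow> fm set \<Rightarrow> code topology" where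
  "t_top L F = topology_generated_by
     {{N \<in> Mod L. evalt (str L N) \<phi> (pts L N js) < of_rat r} | \<phi> js r.
        \<phi> \<in> F \<and> fv \<phi> \<subseteq> {..<length js}}"

definition vaught_star :: "signature \<Rightarrow> code set \<Rightarrow> nat list \<Rightarrow> rat \<Rightarrow> code set" where
  "vaught_star L A js u =
     {N \<in> Mod L.
        let M = str L N;
            U = {y \<in> tail_dense M. tdist M (map y [0..<length js]) (pts L N js) < of_rat u}
        in comeager_in (subtopology (tail_dense_topology M) U) {y \<in> U. code_of L M y \<in> A}}"


section \<open>AE families\<close>

text \<open>A family \<open>P(x\<^sub>0, \<dots>, x\<^sub>n\<^sub>-\<^sub>1)\<close> carries the length \<open>n\<close> of its tuple of variables; \<open>Meet\<close> is used for
  ranks \<open>0\<close> and limits, \<open>Block\<close> for successor ranks.  The real argument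
  is \<open>u\<^sub>P\<close>.\<close>

datatype ae =
    Basic nat fm
  | Meet nat real "nat \<Rightarrow> ae"
  | Block nat real "nat \<Rightarrow> nat \<Rightarrow> ae"

primrec ae_len :: "ae \<Rightarrow> nat" where
  "ae_len (Basic n \<phi>) = n"
| "ae_len (Meet n u p) = n"
| "ae_len (Block n u p) = n"

text \<open>Families of rank \<open>-1\<close> and \<open>0\<close> have no \<open>u\<^sub>P\<close>; the value \<open>0\<close> makes \<open>u\<^sub>P \<ge> u\<^sub>p\<close> void for them.\<close>

primrec ae_rad :: "ae \<Rightarrow> real" where
  "ae_rad (Basic n \<phi>) = 0"
| "ae_rad (Meet n u p) = u"
| "ae_rad (Block n u p) = u"

text \<open>Ranks: \<open>None\<close> stands for \<open>-1\<close>.\<close>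

fun rank_less :: "omega1 option \<Rightarrow> omega1 \<Rightarrow> bool" where
  "rank_less None \<beta> \<longleftrightarrow> True"
| "rank_less (Some \<gamma>) \<beta> \<longleftrightarrow> \<gamma> < \<beta>"

text \<open>\<open>(osuc ^^ n) \<beta>\<close> is \<open>\<beta> + n\<close>.\<close>

inductive ae_family :: "signature \<Rightarrow> fm set \<Rightarrow> omega1 option \<Rightarrow> ae \<Rightarrow> bool"
  for L :: signature and F :: "fm set" where
  basic: "\<phi> \<in> F \<Longrightarrow> fv \<phi> \<subseteq> {..<n} \<Longrightarrow> ae_family L F None (Basic n \<phi>)"
| zero: "(\<forall>k. ae_len (p k) = n \<and> (\<exists>\<gamma>. rank_less \<gamma> 0 \<and> ae_family L F \<gamma> (p k))) \<Longrightarrow>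
    ae_family L F (Some 0) (Meet n 0 p)"
| limit: "is_limit \<beta> \<Longrightarrow>
    (\<forall>k. ae_len (p k) = n \<and> (\<exists>\<gamma>. rank_less \<gamma> \<beta> \<and> ae_family L F \<gamma> (p k))) \<Longrightarrow>
    0 \<le> u \<Longrightarrow> (\<forall>k. ae_rad (p k) \<le> u) \<Longrightarrow>
    ae_family L F (Some \<beta>) (Meet n u p)"
| succ1: "\<beta> = 0 \<or> is_limit \<beta> \<Longrightarrow>
    (\<forall>k l. n \<le> ae_len (p k l) \<and> (\<exists>\<gamma>. rank_less \<gamma> \<beta> \<and> ae_family L F \<gamma> (p k l))) \<Longrightarrow>
    0 \<le> u \<Longrightarrow> (\<forall>k l. ae_rad (p k l) \<le> u) \<Longrightarrow>
    ae_family L F (Some (osuc \<beta>)) (Block n u p)"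
| succ2: "\<beta> = 0 \<or> is_limit \<beta> \<Longrightarrow> 2 \<le> m \<Longrightarrow>
    (\<forall>k l. n \<le> ae_len (p k l) \<and> ae_family L F (Some ((osuc ^^ (m - 2)) \<beta>)) (p k l)) \<Longrightarrow>
    0 \<le> u \<Longrightarrow> (\<forall>k l. ae_rad (p k l) \<le> u) \<Longrightarrow>
    ae_family L F (Some ((osuc ^^ m) \<beta>)) (Block n u p)"

primrec realizes :: "'a mstruct \<Rightarrow> ae \<Rightarrow> 'a list \<Rightarrow> bool" where
  "realizes M (Basic n \<phi>) = (\<lambda>a. length a = n \<and> evalt M \<phi> a = 0)"
| "realizes M (Meet n u p) = (\<lambda>a. length a = n \<and> (\<forall>k. realizes M (p k) a))"
| "realizes M (Block n u p) = (\<lambda>a. length a = n \<and>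
     (\<forall>b\<in>lists (carr M). tdist M b a < u \<longrightarrow>
        (\<forall>v>0. \<forall>k. \<exists>c\<in>lists (carr M). \<exists>l. tdist M c b < v \<and> realizes M (p k l) c)))"

end

theory Submission
  imports Defs
begin

text \<open>
  The stronger claim proved by induction on \<open>\<alpha>\<close> is uniform in the structure: for every set
  \<open>A \<in> \<Pi>\<^sup>0\<^sub>1\<^sub>+\<^sub>\<alpha>(t\<^sub>F)\<close>, every length \<open>n\<close> and radius \<open>w\<close> there is an \<open>\<alpha>\<close>-AE family \<open>P\<close> such that an
  arbitrary \<open>n\<close>-tuple \<open>c\<close> of a separable structure \<open>M\<close>, not necessarily distinguished, realizes \<open>P\<close> iff
  \<open>\<pi>(y) \<in> A\<close> for comeager many \<open>y \<in> D(M)\<close> in the ball of radius \<open>w\<close> about \<open>c\<close>.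

  At a successor write \<open>A = \<Inter>\<^sub>k \<Union>\<^sub>l C\<^sub>k\<^sub>l\<close>.  This set is comeager in the ball about \<open>a\<close> iff for each \<open>k\<close>
  the balls on which some \<open>C\<^sub>k\<^sub>l\<close> is comeager are dense in it: one direction is the Banach category
  theorem, the other is the Baire category theorem together with the Baire property of the \<open>C\<^sub>k\<^sub>l\<close>.
  Since balls about finite tuples form a base of \<open>D(M)\<close>, density is exactly what realization of a
  block says.  For \<open>\<alpha> = 1\<close> the \<open>C\<^sub>k\<^sub>l\<close> are zero sets of formulas and points replace balls; a limit
  stage is an intersection.  A closed set (rank \<open>0\<close>) is comeager in a ball iff it contains the ball,
  which is expressed by the vanishing of a supremum over the ball.
\<close>

text \<open>A block quantifies over all finite tuples of \<open>M\<close>, so the induction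
  hypothesis has to speak of arbitrary tuples; and the family must be fixed before \<open>M\<close>,
  so its construction may not depend on a structure. The Borel index drops by two at a block because
  an intersection of unions is peeled off at once; this matches the step from rank
  \<open>\<beta> + n - 2\<close> to rank \<open>\<beta> + n\<close>. The summand 1 in
  \<open>1 + \<alpha>\<close> places closed sets at rank 0 and is absorbed at limits. Rank 1 is
  special: its members have rank -1, that is, they are single formulas tested for being zero, so
  open sets have to be cut into zero sets. Inner balls get the radii \<open>u / (j + 1)\<close>
  since the radius of a block must dominate those of its members. A code is not a structure;
  \<open>str\<close> selects one, and the selection is harmless because the code determines the
  values of formulas at distinguished points.\<close>

section \<open>Countable ordinals\<close>

lemma osuc_greater: "(\<alpha>::omega1) < osuc \<alpha>"
proof -
  have "\<exists>\<xi>. \<alpha> < \<xi>" using countable_bounded_omega1[of "{\<alpha>}"] by auto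
  then show ?thesis unfolding osuc_def by (rule LeastI_ex)
qed

lemma osuc_least: "(\<alpha>::omega1) < \<beta> \<Longrightarrow> osuc \<alpha> \<le> \<beta>"
  unfolding osuc_def by (rule Least_le)

lemma less_osuc_iff: "\<alpha> < osuc \<beta> \<longleftrightarrow> \<alpha> \<le> \<beta>"
  using osuc_least[of \<beta> \<alpha>] osuc_greater[of \<beta>] by (metis le_less_trans not_le)

lemma zero_le_omega1: "(0::omega1) \<le> \<alpha>"
  unfolding zero_omega1_def by (rule Least_le) simp

lemma one_le_omega1_iff: "1 \<le> \<alpha> \<longleftrightarrow> (0::omega1) < \<alpha>"
  unfolding one_omega1_def by (metis osuc_least less_osuc_iff not_le)

text \<open>The least element in the recursion exists because \<alpha> and the countably many
  earlier values have a common strict upper bound.\<close>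

lemma oadd_above:
  shows oadd_ge_left: "(\<alpha>::omega1) \<le> \<alpha> + \<beta>"
    and oadd_strict_mono: "\<gamma> < \<beta> \<Longrightarrow> \<alpha> + \<gamma> < \<alpha> + \<beta>"
proof -
  let ?P = "\<lambda>\<xi>. \<alpha> \<le> \<xi> \<and> (\<forall>\<gamma>. \<gamma> < \<beta> \<longrightarrow> oadd \<alpha> \<gamma> < \<xi>)"
  have "countable (insert \<alpha> (oadd \<alpha> ` {..<\<beta>}))"
    using countable_lessThan_omega1 by simp
  then obtain \<xi> where "\<forall>\<delta>\<in>insert \<alpha> (oadd \<alpha> ` {..<\<beta>}). \<delta> < \<xi>"
    using countable_bounded_omega1 by blast
  then have "?P \<xi>" by auto
  then have "?P (\<alpha> + \<beta>)"
    unfolding plus_omega1_def oadd.simps[of \<alpha> \<beta>] by (rule LeastI)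
  then show "\<alpha> \<le> \<alpha> + \<beta>" "\<gamma> < \<beta> \<Longrightarrow> \<alpha> + \<gamma> < \<alpha> + \<beta>"
    by (auto simp: plus_omega1_def)
qed

lemma oadd_least: "(\<alpha>::omega1) \<le> \<xi> \<Longrightarrow> (\<And>\<gamma>. \<gamma> < \<beta> \<Longrightarrow> \<alpha> + \<gamma> < \<xi>) \<Longrightarrow> \<alpha> + \<beta> \<le> \<xi>"
  unfolding plus_omega1_def by (subst oadd.simps) (auto intro: Least_le)

lemma oadd_zero: "(\<alpha>::omega1) + 0 = \<alpha>"
  by (metis antisym oadd_least oadd_ge_left not_le order_refl zero_le_omega1)

lemma oadd_osuc: "(\<alpha>::omega1) + osuc \<beta> = osuc (\<alpha> + \<beta>)"
proof (rule antisym)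
  show "\<alpha> + osuc \<beta> \<le> osuc (\<alpha> + \<beta>)"
  proof (rule oadd_least)
    show "\<alpha> \<le> osuc (\<alpha> + \<beta>)"
      using oadd_ge_left[of \<alpha> \<beta>] osuc_greater[of "\<alpha> + \<beta>"] by simp
    show "\<alpha> + \<gamma> < osuc (\<alpha> + \<beta>)" if "\<gamma> < osuc \<beta>" for \<gamma>
      using that oadd_strict_mono[of \<gamma> \<beta> \<alpha>] by (auto simp: less_osuc_iff le_less)
  qed
  show "osuc (\<alpha> + \<beta>) \<le> \<alpha> + osuc \<beta>"
    by (intro osuc_least oadd_strict_mono osuc_greater)
qed

text \<open>A strictly increasing map of ordinals cannot fall below the identity: at a least
  \<open>\<beta>\<close> with \<open>1 + \<beta> < \<beta>\<close> the map would already drop at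
  \<open>1 + \<beta>\<close>.\<close>

lemma le_one_oadd: "(\<beta>::omega1) \<le> 1 + \<beta>"
proof (induction \<beta> rule: less_induct)
  case (less \<beta>)
  show ?case
  proof (rule ccontr)
    assume "\<not> ?case"
    then have "1 + \<beta> < \<beta>" by simp
    from less[OF this] oadd_strict_mono[OF this, of 1] show False by simp
  qed
qed

lemma one_oadd_le_osuc: "(1::omega1) + \<beta> \<le> osuc \<beta>"
proof (induction \<beta> rule: less_induct)
  case (less \<beta>)
  show ?case
  proof (rule oadd_least)
    show "1 \<le> osuc \<beta>"
      unfolding one_le_omega1_iff less_osuc_iff by (rule zero_le_omega1)
    show "1 + \<gamma> < osuc \<beta>" if "\<gamma> < \<beta>" for \<gamma>
      using less[OF that] osuc_least[OF that] by (simp add: less_osuc_iff)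
  qed
qed

lemma one_oadd_limit:
  assumes "is_limit \<beta>"
  shows "1 + \<beta> = \<beta>"
proof (rule antisym)
  show "1 + \<beta> \<le> \<beta>"
  proof (rule oadd_least)
    show "1 \<le> \<beta>"
      using assms zero_le_omega1[of \<beta>] unfolding one_le_omega1_iff is_limit_def by (metis le_less)
    show "1 + \<gamma> < \<beta>" if "\<gamma> < \<beta>" for \<gamma>
      using that assms one_oadd_le_osuc[of \<gamma>] by (auto simp: is_limit_def)
  qed
qed (rule le_one_oadd)

text \<open>Translates a Borel index into the rank at which the induction hypothesis is used. For
  the least \<open>\<gamma>\<close> with \<open>\<zeta> \<le> 1 + \<gamma>\<close> all earlier sums
  lie below \<open>\<zeta>\<close>, so their least strict bound \<open>1 + \<gamma>\<close> does not
  exceed \<open>\<zeta>\<close>.\<close>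

lemma one_oadd_surj:
  assumes "1 \<le> (\<zeta>::omega1)"
  obtains \<gamma> where "\<gamma> \<le> \<zeta>" "\<zeta> = 1 + \<gamma>"
proof -
  define \<gamma> where "\<gamma> = (LEAST \<gamma>. \<zeta> \<le> 1 + \<gamma>)"
  have "\<zeta> \<le> 1 + \<gamma>" unfolding \<gamma>_def by (rule LeastI, rule le_one_oadd)
  moreover have "1 + \<gamma> \<le> \<zeta>"
    using assms not_less_Least[of _ "\<lambda>\<gamma>. \<zeta> \<le> 1 + \<gamma>"]
    by (intro oadd_least) (auto simp: \<gamma>_def not_le)
  moreover have "\<gamma> \<le> \<zeta>" unfolding \<gamma>_def by (rule Least_le, rule le_one_oadd)
  ultimately show thesis using that by auto
qed

lemma omega1_cases:
  obtains "\<alpha> = (0::omega1)" | "is_limit \<alpha>" | \<beta> where "\<alpha> = osuc \<beta>"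
proof (cases "\<alpha> = 0 \<or> is_limit \<alpha>")
  case False
  then obtain \<gamma> where "\<gamma> < \<alpha>" "\<alpha> \<le> osuc \<gamma>" by (auto simp: is_limit_def not_less)
  then have "\<alpha> = osuc \<gamma>" using osuc_least[of \<gamma> \<alpha>] by simp
  then show thesis by (rule that(3))
qed (use that in blast)

text \<open>The normal form in which rule \<open>succ2\<close> of \<open>ae_family\<close> states
  its ranks.\<close>

lemma omega1_limit_plus_nat:
  "\<exists>\<beta> m. (\<beta> = 0 \<or> is_limit \<beta>) \<and> \<alpha> = (osuc ^^ m) \<beta>"
proof (induction \<alpha> rule: less_induct)
  case (less \<alpha>)
  show ?case
  proof (cases \<alpha> rule: omega1_cases)
    case (3 \<beta>)
    then obtain \<delta> m where "\<delta> = 0 \<or> is_limit \<delta>" "\<beta> = (osuc ^^ m) \<delta>"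
      using less[of \<beta>] osuc_greater by blast
    then show ?thesis using 3 by (intro exI[of _ \<delta>] exI[of _ "Suc m"]) simp
  qed (metis funpow_0)+
qed

section \<open>Residual sets\<close>

text \<open>Comeagerness in \<open>V\<close> without passing to a subspace: the \<open>G n\<close>
  are open in all of \<open>T\<close>, and density is tested only on open
  \<open>W \<subseteq> V\<close>. Shrinking \<open>V\<close> or enlarging \<open>S\<close> therefore
  keeps the same witnesses.\<close>

definition residual_on :: "'a topology \<Rightarrow> 'a set \<Rightarrow> 'a set \<Rightarrow> bool" where
  "residual_on T V S \<longleftrightarrow> (\<exists>G. (\<forall>n::nat. openin T (G n) \<and>
     (\<forall>W. openin T W \<longrightarrow> W \<subseteq> V \<longrightarrow> W \<noteq> {} \<longrightarrow> W \<inter> G n \<noteq> {})) \<and> V \<inter> (\<Inter>n. G n) \<subseteq> S)"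

lemma comeager_in_iff_residual_on:
  assumes V: "openin T V"
  shows "comeager_in (subtopology T V) (V \<inter> S) \<longleftrightarrow> residual_on T V S"
proof -
  let ?X = "subtopology T V"
  have top: "topspace ?X = V" using openin_subset[OF V] by auto
  have op: "openin ?X W \<longleftrightarrow> openin T W \<and> W \<subseteq> V" for W
    using V by (simp add: openin_open_subtopology)
  show ?thesis
  proof
    assume "comeager_in ?X (V \<inter> S)"
    then obtain \<N> where \<N>: "countable \<N>" "\<And>N. N \<in> \<N> \<Longrightarrow> nowhere_dense_in ?X N" "V - V \<inter> S = \<Union>\<N>"
      unfolding comeager_in_def meager_in_def top by auto
    \<comment> \<open>Adding the empty set, which is nowhere dense, makes the family nonempty and
      hence the range of a sequence.\<close>
    define f where "f = from_nat_into (insert {} \<N>)"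
    have "range f = insert {} \<N>"
      unfolding f_def using \<N>(1) by (intro range_from_nat_into) auto
    moreover have "nowhere_dense_in ?X {}" by (simp add: nowhere_dense_in_def)
    ultimately have nd: "nowhere_dense_in ?X (f n)" for n
      using \<N>(2) by (metis insert_iff rangeI)
    define G where "G n = V - ?X closure_of (f n)" for n
    have "openin ?X (G n)" for n
      unfolding G_def using openin_diff[of ?X V "?X closure_of (f n)"] top
      by (metis closedin_closure_of openin_topspace)
    then have "openin T (G n)" for n by (simp add: op)
    moreover have "W \<inter> G n \<noteq> {}" if W: "openin T W" "W \<subseteq> V" "W \<noteq> {}" for W n
    proof
      assume "W \<inter> G n = {}"
      then have "W \<subseteq> ?X closure_of (f n)" using W(2) by (auto simp: G_def)
      then have "W \<subseteq> ?X interior_of (?X closure_of (f n))"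
        using W by (intro interior_of_maximal) (simp_all add: op)
      then show False using nd[of n] W(3) by (auto simp: nowhere_dense_in_def)
    qed
    moreover have "V \<inter> (\<Inter>n. G n) \<subseteq> S"
    proof
      fix x assume x: "x \<in> V \<inter> (\<Inter>n. G n)"
      have "f n \<subseteq> ?X closure_of (f n)" for n
        using nd[of n] by (intro closure_of_subset) (simp add: nowhere_dense_in_def)
      then have "x \<notin> f n" for n using x by (auto simp: G_def)
      then have "x \<notin> \<Union>\<N>" using \<open>range f = insert {} \<N>\<close> by (metis UnionE insertI2 rangeE)
      then show "x \<in> S" using x \<N>(3) by auto
    qed
    ultimately show "residual_on T V S" unfolding residual_on_def by blast
  next
    assume "residual_on T V S"
    then obtain G where G: "\<And>n::nat. openin T (G n)"
        "\<And>n W. openin T W \<Longrightarrow> W \<subseteq> V \<Longrightarrow> W \<noteq> {} \<Longrightarrow> W \<inter> G n \<noteq> {}" "V \<inter> (\<Inter>n. G n) \<subseteq> S"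
      unfolding residual_on_def by metis
    \<comment> \<open>\<open>meager_in\<close> asks for equality with the union, so each nowhere
      dense set is cut down to \<open>V - S\<close>.\<close>
    define N where "N n = (V - S) \<inter> (V - G n)" for n
    have "nowhere_dense_in ?X (N n)" for n
    proof -
      have "openin ?X (V \<inter> G n)" using G(1) V by (auto simp: op)
      then have "closedin ?X (V - V \<inter> G n)" by (metis closedin_def openin_closedin_eq top)
      then have "?X closure_of (N n) \<subseteq> V - V \<inter> G n"
        by (intro closure_of_minimal) (auto simp: N_def)
      moreover have "openin ?X (?X interior_of (?X closure_of (N n)))" by simp
      ultimately have "?X interior_of (?X closure_of (N n)) = {}"
        using G(2)[of "?X interior_of (?X closure_of (N n))" n] interior_of_subset[of ?X "?X closure_of (N n)"]
        unfolding op by auto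
      then show ?thesis unfolding nowhere_dense_in_def top by (auto simp: N_def)
    qed
    moreover have "V - V \<inter> S = \<Union>(range N)" using G(3) by (auto simp: N_def)
    ultimately have "meager_in ?X (V - V \<inter> S)"
      unfolding meager_in_def by (intro exI[of _ "range N"]) auto
    then show "comeager_in ?X (V \<inter> S)" unfolding comeager_in_def top by simp
  qed
qed

lemma residual_on_mono: "residual_on T V S \<Longrightarrow> V' \<subseteq> V \<Longrightarrow> S \<subseteq> S' \<Longrightarrow> residual_on T V' S'"
  unfolding residual_on_def by (meson Int_mono order_refl order_trans)

lemma residual_on_open: "openin T V \<Longrightarrow> V \<subseteq> S \<Longrightarrow> residual_on T V S"
  unfolding residual_on_def by (intro exI[of _ "\<lambda>_. V"]) auto

lemma residual_on_INT:
  assumes "\<And>k::nat. residual_on T V (S k)"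
  shows "residual_on T V (\<Inter>k. S k)"
proof -
  obtain G where G: "\<And>k n::nat. openin T (G k n)"
      "\<And>k n W. openin T W \<Longrightarrow> W \<subseteq> V \<Longrightarrow> W \<noteq> {} \<Longrightarrow> W \<inter> G k n \<noteq> {}"
      "\<And>k. V \<inter> (\<Inter>n. G k n) \<subseteq> S k"
    using assms unfolding residual_on_def by metis
  show ?thesis unfolding residual_on_def
  proof (intro exI[of _ "\<lambda>n. case prod_decode n of (k, n) \<Rightarrow> G k n"] conjI allI impI)
    show "V \<inter> (\<Inter>n. case prod_decode n of (k, n) \<Rightarrow> G k n) \<subseteq> (\<Inter>k. S k)"
    proof (intro subsetI INT_I)
      fix x k assume x: "x \<in> V \<inter> (\<Inter>n. case prod_decode n of (k, n) \<Rightarrow> G k n)"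
      have "x \<in> G k n" for n using x by (auto dest!: spec[of _ "prod_encode (k, n)"])
      then show "x \<in> S k" using x G(3)[of k] by auto
    qed
  qed (use G in \<open>auto split: prod.splits\<close>)
qed

text \<open>Banach category theorem over a countable \<pi>-base \<open>B\<close>. The basic sets on
  which \<open>S\<close> is residual have a union dense in \<open>V\<close>; the witnesses on each
  of them are made globally dense, and countability of \<open>B\<close> leaves a countable
  intersection.\<close>

lemma residual_on_local:
  fixes B :: "nat \<Rightarrow> 'a set"
  assumes B: "\<And>W. openin T W \<Longrightarrow> W \<noteq> {} \<Longrightarrow> \<exists>i. B i \<subseteq> W \<and> B i \<noteq> {} \<and> openin T (B i)"
    and loc: "\<And>W. openin T W \<Longrightarrow> W \<noteq> {} \<Longrightarrow> W \<subseteq> V \<Longrightarrow>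
      \<exists>W'\<subseteq>W. openin T W' \<and> W' \<noteq> {} \<and> residual_on T W' S"
  shows "residual_on T V S"
proof -
  define I where "I = {i. openin T (B i) \<and> residual_on T (B i) S}"
  have "\<exists>G. \<forall>i\<in>I. (\<forall>n::nat. openin T (G i n) \<and>
     (\<forall>W. openin T W \<longrightarrow> W \<subseteq> B i \<longrightarrow> W \<noteq> {} \<longrightarrow> W \<inter> G i n \<noteq> {})) \<and> B i \<inter> (\<Inter>n. G i n) \<subseteq> S"
    unfolding I_def residual_on_def by (intro bchoice) auto
  then obtain G where G: "\<And>i n. i \<in> I \<Longrightarrow> openin T (G i n)"
      "\<And>i n W. i \<in> I \<Longrightarrow> openin T W \<Longrightarrow> W \<subseteq> B i \<Longrightarrow> W \<noteq> {} \<Longrightarrow> W \<inter> G i n \<noteq> {}"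
      "\<And>i. i \<in> I \<Longrightarrow> B i \<inter> (\<Inter>n::nat. G i n) \<subseteq> S"
    by metis
  \<comment> \<open>The exterior of \<open>B i\<close> restores density away from \<open>B i\<close>
    and changes nothing inside it.\<close>
  define H where "H i n = (if i \<in> I then G i n \<union> \<Union>{O'. openin T O' \<and> O' \<inter> B i = {}} else topspace T)" for i n
  have res: "residual_on T V (\<Inter>n. H i n)" for i
    unfolding residual_on_def
  proof (intro exI[of _ "H i"] conjI allI impI)
    show "openin T (H i n)" for n
      unfolding H_def using G(1) by auto
    show "W \<inter> H i n \<noteq> {}" if W: "openin T W" "W \<subseteq> V" "W \<noteq> {}" for W n
    proof (cases "i \<in> I \<and> W \<inter> B i \<noteq> {}")
      case True
      then have "openin T (W \<inter> B i)" using W(1) by (auto simp: I_def)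
      then show ?thesis using G(2)[of i "W \<inter> B i" n] True by (auto simp: H_def)
    next
      case False
      then show ?thesis using W openin_subset[OF W(1)] by (auto simp: H_def)
    qed
  qed auto
  have "residual_on T V (\<Union>i\<in>I. B i)"
    unfolding residual_on_def
  proof (intro exI[of _ "\<lambda>_. \<Union>i\<in>I. B i"] conjI allI impI)
    show "openin T (\<Union>i\<in>I. B i)" by (auto simp: I_def)
    show "W \<inter> (\<Union>i\<in>I. B i) \<noteq> {}" if W: "openin T W" "W \<subseteq> V" "W \<noteq> {}" for W
    proof -
      obtain W' where W': "W' \<subseteq> W" "openin T W'" "W' \<noteq> {}" "residual_on T W' S"
        using loc[of W] W by auto
      obtain i where i: "B i \<subseteq> W'" "B i \<noteq> {}" "openin T (B i)" using B[of W'] W' by auto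
      then have "i \<in> I" using residual_on_mono[OF W'(4) i(1)] by (auto simp: I_def)
      then show ?thesis using i W'(1) by auto
    qed
  qed auto
  \<comment> \<open>Index 0 puts a point into some \<open>B i\<close> with \<open>i \<in> I\<close>;
    the later indices supply all the witnesses for that \<open>i\<close>.\<close>
  then have "residual_on T V (\<Inter>k. case k of 0 \<Rightarrow> \<Union>i\<in>I. B i | Suc i \<Rightarrow> \<Inter>n. H i n)"
    using res by (intro residual_on_INT) (auto split: nat.split)
  moreover have "(\<Inter>k. case k of 0 \<Rightarrow> \<Union>i\<in>I. B i | Suc i \<Rightarrow> \<Inter>n. H i n) \<subseteq> S"
  proof
    fix x assume x: "x \<in> (\<Inter>k. case k of 0 \<Rightarrow> \<Union>i\<in>I. B i | Suc i \<Rightarrow> \<Inter>n. H i n)"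
    then obtain i where i: "i \<in> I" "x \<in> B i" using INT_D[OF x, of 0] by auto
    have "x \<in> H i n" for n using INT_D[OF x, of "Suc i"] by auto
    then have "x \<in> G i n" for n using i by (auto simp: H_def)
    then show "x \<in> S" using G(3)[OF i(1)] i(2) by auto
  qed
  ultimately show ?thesis using residual_on_mono by blast
qed

text \<open>Baire's theorem in the subspace \<open>V\<close>, which is completely metrizable because
  it is open. It turns category statements into actual sequences, whose initial segments then
  realize families.\<close>

lemma residual_on_nonempty:
  assumes T: "completely_metrizable_space T" and V: "openin T V" "V \<noteq> {}" and res: "residual_on T V S"
  shows "V \<inter> S \<noteq> {}"
proof -
  obtain G where G: "\<And>n::nat. openin T (G n)"
      "\<And>n W. openin T W \<Longrightarrow> W \<subseteq> V \<Longrightarrow> W \<noteq> {} \<Longrightarrow> W \<inter> G n \<noteq> {}" "V \<inter> (\<Inter>n. G n) \<subseteq> S"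
    using res unfolding residual_on_def by metis
  let ?X = "subtopology T V"
  have top: "topspace ?X = V" using openin_subset[OF V(1)] by auto
  have op: "openin ?X W \<longleftrightarrow> openin T W \<and> W \<subseteq> V" for W
    using V by (simp add: openin_open_subtopology)
  have "?X closure_of (\<Inter>n. V \<inter> G n) = topspace ?X"
  proof (rule Baire_category)
    show "completely_metrizable_space ?X \<or> locally_compact_space ?X \<and> regular_space ?X"
      using completely_metrizable_space_openin[OF T V(1)] by simp
    show "openin ?X W \<and> ?X closure_of W = topspace ?X" if W: "W \<in> range (\<lambda>n. V \<inter> G n)" for W
    proof -
      obtain n where n: "W = V \<inter> G n" using W by auto
      have "W' \<inter> W \<noteq> {}" if "openin ?X W'" "W' \<noteq> {}" for W'
        using G(2)[of W' n] that by (auto simp: op n)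
      then show ?thesis
        using G(1) V(1) unfolding dense_intersects_open n by (auto simp: op Int_commute)
    qed
  qed auto
  then have "(\<Inter>n. V \<inter> G n) \<noteq> {}" using V(2) top by (metis closure_of_empty)
  then show ?thesis using G(3) by auto
qed

text \<open>Stands in for the Baire property: closure under countable unions then needs no more
  than a countable \<open>\<pi>\<close>-base.\<close>

definition locally_decided :: "'a topology \<Rightarrow> 'a set \<Rightarrow> bool" where
  "locally_decided T S \<longleftrightarrow> (\<forall>V. openin T V \<longrightarrow> V \<noteq> {} \<longrightarrow>
     (\<exists>W\<subseteq>V. openin T W \<and> W \<noteq> {} \<and> (residual_on T W S \<or> residual_on T W (- S))))"

lemma locally_decided_open:
  assumes "openin T S" shows "locally_decided T S"
  unfolding locally_decided_def
proof (intro allI impI)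
  fix V assume V: "openin T V" "V \<noteq> {}"
  show "\<exists>W\<subseteq>V. openin T W \<and> W \<noteq> {} \<and> (residual_on T W S \<or> residual_on T W (- S))"
  proof (cases "V \<inter> S = {}")
    case True
    then have "residual_on T V (- S)" using V by (intro residual_on_open) auto
    then show ?thesis using V by blast
  next
    case False
    have "residual_on T (V \<inter> S) S" using V assms by (intro residual_on_open) auto
    then show ?thesis using False V assms by (metis Int_lower1 openin_Int)
  qed
qed

lemma locally_decided_diff:
  assumes "locally_decided T S" shows "locally_decided T (topspace T - S)"
  unfolding locally_decided_def
proof (intro allI impI)
  fix V assume V: "openin T V" "V \<noteq> {}"
  then obtain W where W: "W \<subseteq> V" "openin T W" "W \<noteq> {}" "residual_on T W S \<or> residual_on T W (- S)"
    using assms unfolding locally_decided_def by meson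
  have "residual_on T W (topspace T - S)" if "residual_on T W (- S)"
  proof -
    \<comment> \<open>\<open>- S\<close> is a complement in the whole type; intersecting with the
      open set \<open>W\<close> brings it back into the space.\<close>
    have "residual_on T W (\<Inter>k::nat. if k = 0 then - S else W)"
      using that W by (intro residual_on_INT) (auto intro: residual_on_open)
    then show ?thesis
      by (rule residual_on_mono) (use openin_subset[OF W(2)] in \<open>auto dest: spec[of _ 0] split: if_splits\<close>)
  qed
  moreover have "residual_on T W (- (topspace T - S))" if "residual_on T W S"
    using that by (rule residual_on_mono) auto
  ultimately show "\<exists>W\<subseteq>V. openin T W \<and> W \<noteq> {} \<and>
      (residual_on T W (topspace T - S) \<or> residual_on T W (- (topspace T - S)))"
    using W by blast
qed

text \<open>Unless the complement of the union is residual on \<open>V\<close>, some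
  \<open>- S n\<close> fails to be, since countable intersections preserve residuality. By
  localization it then fails on every nonempty open part of some \<open>W\<close>, and there
  \<open>S n\<close> must win. The first conclusion keeps track of \<open>n\<close>, which
  realization of a block has to name.\<close>

lemma locally_decided_UN:
  fixes B :: "nat \<Rightarrow> 'a set"
  assumes B: "\<And>W. openin T W \<Longrightarrow> W \<noteq> {} \<Longrightarrow> \<exists>i. B i \<subseteq> W \<and> B i \<noteq> {} \<and> openin T (B i)"
    and S: "\<And>n::nat. locally_decided T (S n)"
  shows locally_decided_UN_cases: "openin T V \<Longrightarrow>
      (\<exists>n. \<exists>W\<subseteq>V. openin T W \<and> W \<noteq> {} \<and> residual_on T W (S n)) \<or> residual_on T V (- (\<Union>n. S n))"
    and "locally_decided T (\<Union>n. S n)"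
proof -
  show *: "(\<exists>n. \<exists>W\<subseteq>V. openin T W \<and> W \<noteq> {} \<and> residual_on T W (S n)) \<or> residual_on T V (- (\<Union>n. S n))"
    if V: "openin T V" for V
  proof (rule disjCI)
    assume neg: "\<not> residual_on T V (- (\<Union>n. S n))"
    have "\<exists>n. \<not> residual_on T V (- S n)"
    proof (rule ccontr)
      assume "\<not> ?thesis"
      then have "residual_on T V (\<Inter>n. - S n)" by (intro residual_on_INT) auto
      then show False using neg by simp
    qed
    then obtain n where n: "\<not> residual_on T V (- S n)" by blast
    then obtain W where W: "openin T W" "W \<noteq> {}" "W \<subseteq> V"
        "\<And>W'. W' \<subseteq> W \<Longrightarrow> openin T W' \<Longrightarrow> W' \<noteq> {} \<Longrightarrow> \<not> residual_on T W' (- S n)"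
      using residual_on_local[OF B, of V "- S n"] by metis
    then show "\<exists>n. \<exists>W\<subseteq>V. openin T W \<and> W \<noteq> {} \<and> residual_on T W (S n)"
      using S[of n] unfolding locally_decided_def by (meson order_trans)
  qed
  show "locally_decided T (\<Union>n. S n)"
    unfolding locally_decided_def
  proof (intro allI impI)
    fix V assume V: "openin T V" "V \<noteq> {}"
    from *[OF V(1)] show "\<exists>W\<subseteq>V. openin T W \<and> W \<noteq> {} \<and>
        (residual_on T W (\<Union>n. S n) \<or> residual_on T W (- (\<Union>n. S n)))"
    proof
      assume "\<exists>n. \<exists>W\<subseteq>V. openin T W \<and> W \<noteq> {} \<and> residual_on T W (S n)"
      then show ?thesis by (meson UN_upper UNIV_I order_refl residual_on_mono)
    qed (use V in blast)
  qed
qed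

section \<open>Tail-dense sequences\<close>

text \<open>Entrywise form of \<open>d(y, c) < w\<close>. The two agree for positive
  \<open>w\<close>; positivity matters because \<open>tdist\<close> includes 0 in its
  maximum.\<close>

definition tuple_ball :: "'a mstruct \<Rightarrow> 'a list \<Rightarrow> real \<Rightarrow> (nat \<Rightarrow> 'a) set" where
  "tuple_ball M c w = {y \<in> tail_dense M. \<forall>i<length c. sdist M (y i) (c ! i) < w}"

definition overwrite :: "'a list \<Rightarrow> (nat \<Rightarrow> 'a) \<Rightarrow> nat \<Rightarrow> 'a" where
  "overwrite c y i = (if i < length c then c ! i else y i)"

lemma tdist_less_iff:
  assumes "0 < w"
  shows "tdist M xs ys < w \<longleftrightarrow> (\<forall>i<min (length xs) (length ys). sdist M (xs ! i) (ys ! i) < w)"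
  unfolding tdist_def using assms by (subst Max_less_iff) auto

locale separable_structure =
  fixes L :: signature and M :: "real mstruct" and y0 :: "nat \<Rightarrow> real"
  assumes sig: "is_signature L" and struct: "is_structure L M" and y0: "y0 \<in> tail_dense M"
begin

sublocale Metric_space "carr M" "sdist M"
  using struct by (simp add: is_structure_def)

abbreviation T :: "(nat \<Rightarrow> real) topology" where "T \<equiv> tail_dense_topology M"

lemma tail_dense_iff:
  "y \<in> tail_dense M \<longleftrightarrow> range y \<subseteq> carr M \<and> (\<forall>n. \<forall>x\<in>carr M. \<forall>r>0. \<exists>j\<ge>n. sdist M x (y j) < r)"
proof -
  have "mtopology closure_of (y ` {n..}) = {x \<in> carr M. \<forall>r>0. \<exists>j\<ge>n. sdist M x (y j) < r}"
    if "range y \<subseteq> carr M" for n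
    unfolding metric_closure_of using that by (auto simp: image_subset_iff Bex_def)
  moreover have "{x \<in> carr M. P x} = carr M \<longleftrightarrow> (\<forall>x\<in>carr M. P x)" for P by auto
  ultimately show ?thesis unfolding tail_dense_def by (cases "range y \<subseteq> carr M") simp_all
qed

lemma tail_dense_carr: "y \<in> tail_dense M \<Longrightarrow> y i \<in> carr M"
  by (auto simp: tail_dense_def)

text \<open>From position \<open>length c\<close> on nothing changes, and those tails are already
  dense. Hence every finite tuple of \<open>M\<close> begins a point of \<open>D(M)\<close>.\<close>

lemma overwrite_tail_dense:
  assumes "c \<in> lists (carr M)" and y: "y \<in> tail_dense M"
  shows "overwrite c y \<in> tail_dense M"
  unfolding tail_dense_iff
proof (intro conjI allI ballI impI)
  show "range (overwrite c y) \<subseteq> carr M"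
    using assms tail_dense_carr by (auto simp: overwrite_def in_lists_conv_set)
  fix n x and r :: real assume "x \<in> carr M" "r > 0"
  then obtain j where "j \<ge> max n (length c)" "sdist M x (y j) < r"
    using y unfolding tail_dense_iff by blast
  then show "\<exists>j\<ge>n. sdist M x (overwrite c y j) < r"
    by (intro exI[of _ j]) (auto simp: overwrite_def)
qed

lemma overwrite_in_tuple_ball:
  assumes "c \<in> lists (carr M)" "0 < w"
  shows "overwrite c y0 \<in> tuple_ball M c w"
  using assms overwrite_tail_dense[OF assms(1) y0] by (auto simp: tuple_ball_def overwrite_def in_lists_conv_set)

lemma carr_nonempty: "carr M \<noteq> {}"
  using y0 tail_dense_carr by blast

lemma topspace_product:
  "topspace (product_topology (\<lambda>_::nat. mtopology) UNIV) = {y. range y \<subseteq> carr M}"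
  by (auto simp: PiE_def Pi_def)

lemma topspace_T: "topspace T = tail_dense M"
  unfolding tail_dense_topology_def topspace_subtopology topspace_product
  by (auto simp: tail_dense_def)

lemma openin_tuple_ball:
  assumes "c \<in> lists (carr M)"
  shows "openin T (tuple_ball M c w)"
proof -
  let ?P = "product_topology (\<lambda>_::nat. mtopology) UNIV"
  have "openin ?P {y \<in> topspace ?P. y i \<in> mball x w}" for i x
    by (intro openin_continuous_map_preimage[of _ mtopology] continuous_map_product_projection) auto
  then have "openin ?P (topspace ?P \<inter> (\<Inter>i<length c. {y \<in> topspace ?P. y i \<in> mball (c ! i) w}))"
    by (subst Int_commute) (rule openin_INT, simp_all only: finite_lessThan)
  moreover have "tuple_ball M c w =
      (topspace ?P \<inter> (\<Inter>i<length c. {y \<in> topspace ?P. y i \<in> mball (c ! i) w})) \<inter> tail_dense M"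
    unfolding topspace_product using assms
    by (auto simp: tuple_ball_def in_lists_conv_set commute tail_dense_def)
  ultimately show ?thesis
    unfolding tail_dense_topology_def openin_subtopology by blast
qed

text \<open>A basic open set of the product constrains finitely many coordinates; a length beyond
  all of them and a radius below all of theirs give the ball.\<close>

lemma openin_T_iff:
  "openin T V \<longleftrightarrow> V \<subseteq> tail_dense M \<and> (\<forall>y\<in>V. \<exists>m e. 0 < e \<and> tuple_ball M (map y [0..<m]) e \<subseteq> V)"
proof (intro iffI conjI ballI)
  assume V: "openin T V"
  then show "V \<subseteq> tail_dense M" using openin_subset topspace_T by blast
  fix y assume y: "y \<in> V"
  obtain W where W: "openin (product_topology (\<lambda>_::nat. mtopology) UNIV) W" "V = W \<inter> tail_dense M"
    using V unfolding tail_dense_topology_def openin_subtopology by auto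
  then obtain U where U: "finite {i. U i \<noteq> carr M}" "\<And>i. openin mtopology (U i)"
      "\<And>i. y i \<in> U i" "Pi\<^sub>E UNIV U \<subseteq> W"
    using y unfolding openin_product_topology_alt by (auto simp: PiE_def Pi_def)
  let ?K = "{i. U i \<noteq> carr M}"
  have "\<exists>r>0. mball (y i) r \<subseteq> U i" for i
    using U(2,3)[of i] unfolding openin_mtopology by blast
  then obtain r where r: "\<And>i. r i > 0" "\<And>i. mball (y i) (r i) \<subseteq> U i" by metis
  \<comment> \<open>The inserted 1, and 0 in the next line, cover the case that no coordinate is
    constrained.\<close>
  define e where "e = Min (insert 1 (r ` ?K))"
  define m where "m = Suc (Max (insert 0 ?K))"
  have e: "e > 0" "\<And>i. i \<in> ?K \<Longrightarrow> e \<le> r i"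
    using U(1) r(1) by (auto simp: e_def)
  have m: "i < m" if "i \<in> ?K" for i
    using U(1) that Max_ge[of "insert 0 ?K" i] by (auto simp: m_def less_Suc_eq_le)
  have "tuple_ball M (map y [0..<m]) e \<subseteq> V"
  proof
    fix z assume z: "z \<in> tuple_ball M (map y [0..<m]) e"
    then have zt: "z \<in> tail_dense M" by (simp add: tuple_ball_def)
    have "z i \<in> U i" for i
    proof (cases "i \<in> ?K")
      case True
      then have "sdist M (z i) (y i) < e" using m z by (auto simp: tuple_ball_def)
      then have "sdist M (y i) (z i) < r i" using e(2)[OF True] commute[of "y i" "z i"] by simp
      moreover have "y i \<in> carr M" using y W tail_dense_carr by auto
      ultimately have "z i \<in> mball (y i) (r i)" using tail_dense_carr[OF zt] by simp
      then show ?thesis using r(2) by blast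
    qed (use tail_dense_carr[OF zt] in auto)
    then show "z \<in> V" using U(4) W(2) zt by auto
  qed
  then show "\<exists>m e. 0 < e \<and> tuple_ball M (map y [0..<m]) e \<subseteq> V" using e(1) by blast
next
  assume V: "V \<subseteq> tail_dense M \<and> (\<forall>y\<in>V. \<exists>m e. 0 < e \<and> tuple_ball M (map y [0..<m]) e \<subseteq> V)"
  show "openin T V"
  proof (subst openin_subopen, intro ballI)
    fix y assume y: "y \<in> V"
    then obtain m e where me: "0 < e" "tuple_ball M (map y [0..<m]) e \<subseteq> V" using V by blast
    have yt: "y \<in> tail_dense M" using V y by auto
    then have "openin T (tuple_ball M (map y [0..<m]) e)"
      using tail_dense_carr by (intro openin_tuple_ball) auto
    moreover have "y \<in> tuple_ball M (map y [0..<m]) e"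
      using yt me(1) tail_dense_carr[OF yt] by (auto simp: tuple_ball_def)
    ultimately show "\<exists>W. openin T W \<and> y \<in> W \<and> W \<subseteq> V" using me(2) by blast
  qed
qed

text \<open>A longer centre gives a smaller ball. The lower bound \<open>n\<close> is there because
  members of a block have at least as many variables as the block.\<close>

lemma openin_T_tuple_ball_subset:
  assumes "openin T V" "y \<in> V"
  obtains m e where "m \<ge> n" "0 < e" "tuple_ball M (map y [0..<m]) e \<subseteq> V"
proof -
  obtain m e where me: "0 < e" "tuple_ball M (map y [0..<m]) e \<subseteq> V"
    using assms unfolding openin_T_iff by blast
  have "tuple_ball M (map y [0..<max n m]) e \<subseteq> tuple_ball M (map y [0..<m]) e"
    by (auto simp: tuple_ball_def)
  then show thesis using me that[of "max n m" e] by auto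
qed

text \<open>\<open>D(M)\<close> is a G-delta set in the product: density is tested at the countably
  many points \<open>y0 i\<close>, with radii \<open>1 / (m + 1)\<close> and tails from
  \<open>n\<close> on.\<close>

lemma completely_metrizable_T: "completely_metrizable_space T"
proof -
  let ?P = "product_topology (\<lambda>_::nat. mtopology) UNIV"
  have comp: "completely_metrizable_space ?P"
    using completely_metrizable_space_mtopology struct
    unfolding completely_metrizable_space_product_topology is_structure_def by auto
  define G where "G = (\<lambda>(n, i, m). {y \<in> topspace ?P. \<exists>j\<ge>n. sdist M (y0 i) (y j) < inverse (real (Suc m))})"
  have opG: "openin ?P (G q)" for q
  proof -
    obtain n i m where q: "q = (n, i, m)" by (cases q)
    have "openin ?P {y \<in> topspace ?P. y j \<in> mball (y0 i) (inverse (real (Suc m)))}" for j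
      by (intro openin_continuous_map_preimage[of _ mtopology] continuous_map_product_projection) auto
    then have "openin ?P (\<Union>j\<in>{n..}. {y \<in> topspace ?P. y j \<in> mball (y0 i) (inverse (real (Suc m)))})"
      by (intro openin_Union) auto
    moreover have "(\<Union>j\<in>{n..}. {y \<in> topspace ?P. y j \<in> mball (y0 i) (inverse (real (Suc m)))}) = G q"
      using tail_dense_carr[OF y0] by (auto simp: G_def q topspace_product simp del: of_nat_Suc)
    ultimately show ?thesis by simp
  qed
  have "tail_dense M = (\<Inter>q. G q)"
  proof
    show "tail_dense M \<subseteq> (\<Inter>q. G q)"
    proof (intro subsetI INT_I)
      fix y q assume y: "y \<in> tail_dense M"
      obtain n i m :: nat where q: "q = (n, i, m)" by (cases q)
      have "\<exists>j\<ge>n. sdist M (y0 i) (y j) < inverse (real (Suc m))"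
        using y tail_dense_carr[OF y0, of i] unfolding tail_dense_iff by simp
      then show "y \<in> G q"
        using y unfolding G_def q topspace_product tail_dense_iff by simp
    qed
    show "(\<Inter>q. G q) \<subseteq> tail_dense M"
    proof
      fix y assume y: "y \<in> (\<Inter>q. G q)"
      have rg: "range y \<subseteq> carr M"
        using INT_D[OF y, of "(0, 0, 0)"] topspace_product unfolding G_def by auto
      have "\<exists>j\<ge>n. sdist M x (y j) < r" if x: "x \<in> carr M" and r: "r > 0" for n x and r :: real
      proof -
        obtain i where i: "sdist M x (y0 i) < r / 2"
          using y0 x r unfolding tail_dense_iff by (metis half_gt_zero)
        obtain m where m: "inverse (real (Suc m)) < r / 2" using r reals_Archimedean[of "r / 2"] by auto
        obtain j where j: "j \<ge> n" "sdist M (y0 i) (y j) < inverse (real (Suc m))"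
          using INT_D[OF y, of "(n, i, m)"] by (auto simp: G_def)
        have "sdist M x (y j) \<le> sdist M x (y0 i) + sdist M (y0 i) (y j)"
          using x rg tail_dense_carr[OF y0] by (intro triangle) auto
        then show ?thesis using i j m by (intro exI[of _ j]) linarith
      qed
      then show "y \<in> tail_dense M" using rg unfolding tail_dense_iff by blast
    qed
  qed
  moreover have "gdelta_in ?P (\<Inter>(range G))"
    by (rule gdelta_in_Inter) (auto intro: open_imp_gdelta_in opG)
  ultimately show ?thesis
    unfolding tail_dense_topology_def by (intro completely_metrizable_space_gdelta_in comp) simp
qed

definition basic_nbhd :: "nat \<Rightarrow> (nat \<Rightarrow> real) set" where
  "basic_nbhd k = (case prod_decode k of (s, n) \<Rightarrow> tuple_ball M (map y0 (list_decode s)) (inverse (real (Suc n))))"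

text \<open>Only a \<pi>-base is claimed, so the ball may miss the chosen \<open>y\<close>.
  Replacing each \<open>y i\<close> by an entry of \<open>y0\<close> within \<open>e / 2\<close> and
  taking a radius below \<open>e / 2\<close> keeps it inside the ball about \<open>y\<close>; its
  centre begins a tail-dense sequence, so it is nonempty.\<close>

lemma basic_nbhd:
  assumes W: "openin T W" "W \<noteq> {}"
  shows "\<exists>i. basic_nbhd i \<subseteq> W \<and> basic_nbhd i \<noteq> {} \<and> openin T (basic_nbhd i)"
proof -
  obtain y where y: "y \<in> W" using W by blast
  obtain m e where me: "0 < e" "tuple_ball M (map y [0..<m]) e \<subseteq> W"
    using openin_T_tuple_ball_subset[OF W(1) y] by metis
  have yc: "y i \<in> carr M" for i using y openin_subset[OF W(1)] topspace_T tail_dense_carr by blast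
  have "\<exists>j. sdist M (y i) (y0 j) < e / 2" for i
    using y0 yc[of i] me(1) unfolding tail_dense_iff by (metis half_gt_zero)
  then obtain j where j: "\<And>i. sdist M (y i) (y0 (j i)) < e / 2" by metis
  obtain n where n: "inverse (real (Suc n)) < e / 2" using me(1) reals_Archimedean[of "e / 2"] by auto
  define c where "c = map y0 (map j [0..<m])"
  have c: "c \<in> lists (carr M)" using tail_dense_carr[OF y0] by (auto simp: c_def)
  have "tuple_ball M c (inverse (real (Suc n))) \<subseteq> tuple_ball M (map y [0..<m]) e"
  proof
    fix z assume z: "z \<in> tuple_ball M c (inverse (real (Suc n)))"
    have "sdist M (z i) (y i) < e" if "i < m" for i
    proof -
      have "sdist M (z i) (y i) \<le> sdist M (z i) (y0 (j i)) + sdist M (y0 (j i)) (y i)"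
        using z tail_dense_carr[OF y0] yc tail_dense_carr by (intro triangle) (auto simp: tuple_ball_def)
      moreover have "sdist M (z i) (y0 (j i)) < inverse (real (Suc n))"
        using z that by (auto simp: tuple_ball_def c_def)
      ultimately show ?thesis using j[of i] n commute[of "y i" "y0 (j i)"] by linarith
    qed
    then show "z \<in> tuple_ball M (map y [0..<m]) e" using z by (auto simp: tuple_ball_def)
  qed
  moreover have "basic_nbhd (prod_encode (list_encode (map j [0..<m]), n)) = tuple_ball M c (inverse (real (Suc n)))"
    by (simp add: basic_nbhd_def c_def)
  moreover have "overwrite c y0 \<in> tuple_ball M c (inverse (real (Suc n)))"
    using c by (intro overwrite_in_tuple_ball) auto
  ultimately show ?thesis using openin_tuple_ball[OF c] me(2) by (metis empty_iff order_trans)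
qed

lemmas residual_on_local_T = residual_on_local[OF basic_nbhd]
lemmas locally_decided_UN_T = locally_decided_UN[OF basic_nbhd]
lemmas locally_decided_UN_cases_T = locally_decided_UN_cases[OF basic_nbhd]

end

section \<open>Evaluation of formulas\<close>

lemma eval_cong_fv: "(\<And>i. i \<in> fv \<phi> \<Longrightarrow> e i = e' i) \<Longrightarrow> eval M \<phi> e = eval M \<phi> e'"
proof (induction \<phi> arbitrary: e e')
  case (Atom i xs)
  then have "map e xs = map e' xs" by simp
  then show ?case by (simp only: eval.simps)
next
  case (Var_sup \<phi>)
  have "eval M \<phi> (case_nat x e) = eval M \<phi> (case_nat x e')" for x
    using Var_sup.prems by (intro Var_sup.IH) (auto split: nat.split)
  then show ?case by simp
next
  case (Var_inf \<phi>)
  have "eval M \<phi> (case_nat x e) = eval M \<phi> (case_nat x e')" for x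
    using Var_inf.prems by (intro Var_inf.IH) (auto split: nat.split)
  then show ?case by simp
next
  case (Plus \<phi> \<psi>)
  from Plus.IH(1)[of e e'] Plus.IH(2)[of e e'] Plus.prems show ?case by simp
next
  case (Maxi \<phi> \<psi>)
  from Maxi.IH(1)[of e e'] Maxi.IH(2)[of e e'] Maxi.prems show ?case by simp
next
  case (Scale r \<phi>)
  from Scale.IH[of e e'] Scale.prems show ?case by simp
next
  case (Count_sup f)
  have "eval M (f n) e = eval M (f n) e'" for n
    using Count_sup.prems by (intro Count_sup.IH) auto
  then show ?case by simp
next
  case (Count_inf f)
  have "eval M (f n) e = eval M (f n) e'" for n
    using Count_inf.prems by (intro Count_inf.IH) auto
  then show ?case by simp
qed simp

lemma eval_subst: "eval M (subst \<phi> \<sigma>) e = eval M \<phi> (\<lambda>i. e (\<sigma> i))"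
proof (induction \<phi> arbitrary: \<sigma> e)
  case (Atom i xs)
  then show ?case by (simp add: comp_def)
next
  case (Var_sup \<phi>)
  have "(\<lambda>i. case_nat x e (case_nat 0 (\<lambda>i. Suc (\<sigma> i)) i)) = case_nat x (\<lambda>i. e (\<sigma> i))" for x
    by (auto simp: fun_eq_iff split: nat.split)
  then show ?case by (simp add: Var_sup)
next
  case (Var_inf \<phi>)
  have "(\<lambda>i. case_nat x e (case_nat 0 (\<lambda>i. Suc (\<sigma> i)) i)) = case_nat x (\<lambda>i. e (\<sigma> i))" for x
    by (auto simp: fun_eq_iff split: nat.split)
  then show ?case by (simp add: Var_inf)
qed simp_all

lemma evalt_eq_eval:
  assumes "fv \<phi> \<subseteq> {..<length xs}" "\<And>i. i < length xs \<Longrightarrow> xs ! i = e i"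
  shows "evalt M \<phi> xs = eval M \<phi> e"
  unfolding evalt_def using assms by (intro eval_cong_fv) auto

lemma finite_fv: "\<phi> \<in> formulas L \<Longrightarrow> finite (fv \<phi>)"
proof (induction rule: formulas.induct)
  case (6 \<phi>)
  have "{i. Suc i \<in> fv \<phi>} = Suc -` fv \<phi>" by auto
  then show ?case using 6 by (simp add: finite_vimageI)
next
  case (7 \<phi>)
  have "{i. Suc i \<in> fv \<phi>} = Suc -` fv \<phi>" by auto
  then show ?case using 7 by (simp add: finite_vimageI)
next
  case (8 f)
  then obtain X where "finite X" "\<And>n. fv (f n) = X" by (auto simp: combinable_def)
  then show ?case by simp
next
  case (9 f)
  then obtain X where "finite X" "\<And>n. fv (f n) = X" by (auto simp: combinable_def)
  then show ?case by simp
qed auto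

lemma fv_bounded:
  assumes "\<phi> \<in> formulas L"
  obtains m where "fv \<phi> \<subseteq> {..<m}"
proof -
  have "fv \<phi> \<subseteq> {..<Suc (Max (insert 0 (fv \<phi>)))}"
    using finite_fv[OF assms] by (auto simp: less_Suc_eq_le)
  then show thesis by (rule that)
qed

text \<open>Lets quantifiers and countable suprema inherit the \<open>\<delta>\<close> of their
  arguments.\<close>

lemma cSUP_close:
  fixes f g :: "'i \<Rightarrow> real"
  assumes "I \<noteq> {}" "bdd_above (f ` I)" "bdd_above (g ` I)" "\<And>i. i \<in> I \<Longrightarrow> \<bar>f i - g i\<bar> \<le> \<epsilon>"
  shows "\<bar>(SUP i\<in>I. f i) - (SUP i\<in>I. g i)\<bar> \<le> \<epsilon>"
proof -
  have "f i \<le> (SUP i\<in>I. g i) + \<epsilon>" if "i \<in> I" for i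
    using cSUP_upper[OF that assms(3)] assms(4)[OF that] by linarith
  then have "(SUP i\<in>I. f i) \<le> (SUP i\<in>I. g i) + \<epsilon>" using assms(1) by (intro cSUP_least)
  moreover have "g i \<le> (SUP i\<in>I. f i) + \<epsilon>" if "i \<in> I" for i
    using cSUP_upper[OF that assms(2)] assms(4)[OF that] by linarith
  then have "(SUP i\<in>I. g i) \<le> (SUP i\<in>I. f i) + \<epsilon>" using assms(1) by (intro cSUP_least)
  ultimately show ?thesis by linarith
qed

lemma cINF_eq_uminus_cSUP: "(INF i\<in>I. f i) = - (SUP i\<in>I. - f i)" for f :: "'i \<Rightarrow> real"
  by (simp add: Inf_real_def image_image)

lemma cINF_close:
  fixes f g :: "'i \<Rightarrow> real"
  assumes "I \<noteq> {}" "bdd_below (f ` I)" "bdd_below (g ` I)" "\<And>i. i \<in> I \<Longrightarrow> \<bar>f i - g i\<bar> \<le> \<epsilon>"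
  shows "\<bar>(INF i\<in>I. f i) - (INF i\<in>I. g i)\<bar> \<le> \<epsilon>"
proof -
  have "bdd_above ((\<lambda>i. - f i) ` I)" "bdd_above ((\<lambda>i. - g i) ` I)"
    using assms(2,3) bdd_above_uminus[of "f ` I"] bdd_above_uminus[of "g ` I"] by (simp_all add: image_image)
  from cSUP_close[OF assms(1) this, of \<epsilon>] assms(4) show ?thesis
    unfolding cINF_eq_uminus_cSUP by (simp add: abs_minus_commute)
qed

text \<open>A formula defines a bounded, uniformly continuous function of its free variables; this is all
  that is needed of the moduli.\<close>

definition bounded_in :: "'a mstruct \<Rightarrow> fm \<Rightarrow> real \<Rightarrow> bool" where
  "bounded_in M \<phi> b \<longleftrightarrow> (\<forall>e. range e \<subseteq> carr M \<longrightarrow> \<bar>eval M \<phi> e\<bar> \<le> b)"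

definition close_in :: "'a mstruct \<Rightarrow> fm \<Rightarrow> real \<Rightarrow> real \<Rightarrow> bool" where
  "close_in M \<phi> \<delta> \<epsilon> \<longleftrightarrow> (\<forall>e e'. range e \<subseteq> carr M \<longrightarrow> range e' \<subseteq> carr M \<longrightarrow>
     (\<forall>i\<in>fv \<phi>. sdist M (e i) (e' i) < \<delta>) \<longrightarrow> \<bar>eval M \<phi> e - eval M \<phi> e'\<bar> \<le> \<epsilon>)"

lemma modulus_small:
  assumes "is_modulus \<Delta>" "0 < \<epsilon>"
  obtains \<delta> where "0 < \<delta>" "\<And>r. 0 \<le> r \<Longrightarrow> r < \<delta> \<Longrightarrow> \<Delta> r \<le> \<epsilon>"
proof -
  have "continuous_on {0..} \<Delta>" "\<Delta> 0 = 0" using assms(1) by (auto simp: is_modulus_def)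
  then obtain \<delta> where "\<delta> > 0" "\<And>r. r \<in> {0..} \<Longrightarrow> dist r 0 < \<delta> \<Longrightarrow> dist (\<Delta> r) 0 < \<epsilon>"
    using assms(2) unfolding continuous_on_iff by (metis atLeast_iff order_refl)
  then show thesis by (intro that[of \<delta>]) (fastforce simp: dist_real_def)+
qed

context separable_structure
begin

lemma case_nat_carr: "range e \<subseteq> carr M \<Longrightarrow> x \<in> carr M \<Longrightarrow> range (case_nat x e) \<subseteq> carr M"
  by (auto split: nat.splits simp: image_subset_iff)

text \<open>The bound variable receives the same point on both sides, so its distance is 0, which is
  below the positive \<open>\<delta>\<close>.\<close>

lemma close_in_case_nat:
  assumes "close_in M \<phi> \<delta> \<epsilon>" "\<delta> > 0" and e: "range e \<subseteq> carr M" "range e' \<subseteq> carr M"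
    and x: "x \<in> carr M" and d: "\<And>i. Suc i \<in> fv \<phi> \<Longrightarrow> sdist M (e i) (e' i) < \<delta>"
  shows "\<bar>eval M \<phi> (case_nat x e) - eval M \<phi> (case_nat x e')\<bar> \<le> \<epsilon>"
proof -
  have "sdist M (case_nat x e i) (case_nat x e' i) < \<delta>" if "i \<in> fv \<phi>" for i
    using that assms(2) d zero[OF x x] by (cases i) auto
  then show ?thesis
    using assms(1) case_nat_carr[OF e(1) x] case_nat_carr[OF e(2) x] unfolding close_in_def by blast
qed

text \<open>One modulus and one bound serve all \<open>f n\<close>, so \<open>b\<close> and
  \<open>\<delta>\<close> can be chosen before \<open>n\<close>.\<close>

lemma fm_respects_bounded_close:
  assumes "is_modulus \<Delta>" "\<And>n::nat. fm_respects L (f n) \<Delta> lo hi" "\<And>n. fv (f n) = X" "finite X"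
  shows "\<exists>b. \<forall>n. bounded_in M (f n) b"
    and "\<epsilon> > 0 \<Longrightarrow> \<exists>\<delta>>0. \<forall>n. close_in M (f n) \<delta> \<epsilon>"
proof -
  have *: "lo \<le> eval M (f n) e \<and> eval M (f n) e \<le> hi \<and>
      \<bar>eval M (f n) e - eval M (f n) e'\<bar> \<le> \<Delta> (Max (insert 0 ((\<lambda>i. sdist M (e i) (e' i)) ` X)))"
    if "range e \<subseteq> carr M" "range e' \<subseteq> carr M" for n e e'
    using assms(2)[of n] struct that unfolding fm_respects_def assms(3) by blast
  then show "\<exists>b. \<forall>n. bounded_in M (f n) b"
    unfolding bounded_in_def by (intro exI[of _ "max \<bar>lo\<bar> \<bar>hi\<bar>"]) (smt (verit, best))
  assume "\<epsilon> > 0"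
  from assms(1) this obtain \<delta> where \<delta>: "0 < \<delta>" "\<And>r. 0 \<le> r \<Longrightarrow> r < \<delta> \<Longrightarrow> \<Delta> r \<le> \<epsilon>"
    by (rule modulus_small) auto
  have "close_in M (f n) \<delta> \<epsilon>" for n
    unfolding close_in_def
  proof (intro allI impI)
    fix e e' assume e: "range e \<subseteq> carr M" "range e' \<subseteq> carr M" "\<forall>i\<in>fv (f n). sdist M (e i) (e' i) < \<delta>"
    let ?r = "Max (insert 0 ((\<lambda>i. sdist M (e i) (e' i)) ` X))"
    have "?r < \<delta>" "0 \<le> ?r" using e(3) \<delta>(1) assms(3,4) by auto
    then show "\<bar>eval M (f n) e - eval M (f n) e'\<bar> \<le> \<epsilon>" using *[OF e(1,2), of n] \<delta>(2)[of ?r] by linarith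
  qed
  then show "\<exists>\<delta>>0. \<forall>n. close_in M (f n) \<delta> \<epsilon>" using \<delta>(1) by blast
qed

lemma bdd_image_Var:
  assumes "bounded_in M \<phi> b" "range e \<subseteq> carr M"
  shows "bdd_above ((\<lambda>x. eval M \<phi> (case_nat x e)) ` carr M)"
    and "bdd_below ((\<lambda>x. eval M \<phi> (case_nat x e)) ` carr M)"
proof -
  have "\<bar>eval M \<phi> (case_nat x e)\<bar> \<le> b" if "x \<in> carr M" for x
    using assms(1) case_nat_carr[OF assms(2) that] unfolding bounded_in_def by blast
  then show "bdd_above ((\<lambda>x. eval M \<phi> (case_nat x e)) ` carr M)"
    "bdd_below ((\<lambda>x. eval M \<phi> (case_nat x e)) ` carr M)"
    by (auto intro!: bdd_aboveI2[of _ _ b] bdd_belowI2[of _ "- b"] simp: abs_le_iff) (metis minus_le_iff)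
qed

lemma bdd_image_Count:
  assumes "\<And>n::nat. bounded_in M (f n) b" "range e \<subseteq> carr M"
  shows "bdd_above (range (\<lambda>n. eval M (f n) e))" "bdd_below (range (\<lambda>n. eval M (f n) e))"
proof -
  have "\<bar>eval M (f n) e\<bar> \<le> b" for n
    using assms unfolding bounded_in_def by blast
  then show "bdd_above (range (\<lambda>n. eval M (f n) e))" "bdd_below (range (\<lambda>n. eval M (f n) e))"
    by (auto intro!: bdd_aboveI2[of _ _ b] bdd_belowI2[of _ "- b"] simp: abs_le_iff) (metis minus_le_iff)
qed

lemma abs_cSUP_le:
  assumes "I \<noteq> {}" "\<And>i. i \<in> I \<Longrightarrow> \<bar>f i\<bar> \<le> (b::real)"
  shows "\<bar>SUP i\<in>I. f i\<bar> \<le> b" "\<bar>INF i\<in>I. f i\<bar> \<le> b"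
  using cSup_abs_le[of "f ` I" b] cInf_abs_ge[of "f ` I" b] assms by auto

text \<open>Boundedness and uniform continuity go through the induction together because real
  suprema behave well only on bounded sets. For countable suprema and infima, uniformity in
  \<open>n\<close> comes from \<open>combinable\<close>; separate induction hypotheses would give a
  \<open>\<delta>\<close> for each \<open>n\<close>.\<close>

lemma formula_bounded_close:
  assumes "\<phi> \<in> formulas L"
  shows "(\<exists>b. bounded_in M \<phi> b) \<and> (\<forall>\<epsilon>>0. \<exists>\<delta>>0. close_in M \<phi> \<delta> \<epsilon>)"
  using assms
proof (induction rule: formulas.induct)
  case (1 i xs)
  have mod: "is_modulus (modulus L i)" using sig 1 by (auto simp: is_signature_def)
  have int: "lower L i \<le> interp M i as \<and> interp M i as \<le> upper L i \<and>
        \<bar>interp M i as - interp M i bs\<bar> \<le> modulus L i (tdist M as bs)"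
    if "as \<in> lists (carr M)" "bs \<in> lists (carr M)" "length as = arity L i" "length bs = arity L i" for as bs
    using struct 1(1) that unfolding is_structure_def by blast
  have "bounded_in M (Atom i xs) (max \<bar>lower L i\<bar> \<bar>upper L i\<bar>)"
    unfolding bounded_in_def
  proof (intro allI impI)
    fix e :: "nat \<Rightarrow> real" assume "range e \<subseteq> carr M"
    then have "map e xs \<in> lists (carr M)" by (auto simp: image_subset_iff)
    then show "\<bar>eval M (Atom i xs) e\<bar> \<le> max \<bar>lower L i\<bar> \<bar>upper L i\<bar>"
      using int[of "map e xs" "map e xs"] 1(2) by auto
  qed
  moreover have "\<exists>\<delta>>0. close_in M (Atom i xs) \<delta> \<epsilon>" if "\<epsilon> > 0" for \<epsilon>
  proof -
    from mod that obtain \<delta> where \<delta>: "0 < \<delta>" "\<And>r. 0 \<le> r \<Longrightarrow> r < \<delta> \<Longrightarrow> modulus L i r \<le> \<epsilon>"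
      by (rule modulus_small) auto
    have "close_in M (Atom i xs) \<delta> \<epsilon>"
      unfolding close_in_def
    proof (intro allI impI)
      fix e e' :: "nat \<Rightarrow> real"
      assume e: "range e \<subseteq> carr M" "range e' \<subseteq> carr M"
        "\<forall>i\<in>fv (Atom i xs). sdist M (e i) (e' i) < \<delta>"
      have "tdist M (map e xs) (map e' xs) < \<delta>"
        unfolding tdist_less_iff[OF \<delta>(1)] using e(3) by auto
      moreover have "0 \<le> tdist M (map e xs) (map e' xs)" unfolding tdist_def by (intro Max_ge) auto
      moreover have "map e xs \<in> lists (carr M)" "map e' xs \<in> lists (carr M)"
        using e by (auto simp: image_subset_iff)
      ultimately show "\<bar>eval M (Atom i xs) e - eval M (Atom i xs) e'\<bar> \<le> \<epsilon>"
        using int[of "map e xs" "map e' xs"] 1(2) \<delta>(2)[of "tdist M (map e xs) (map e' xs)"] by auto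
    qed
    then show ?thesis using \<delta>(1) by blast
  qed
  ultimately show ?case by blast
next
  case 2
  show ?case by (auto simp: bounded_in_def close_in_def intro: exI[of _ 1])
next
  case (3 \<phi> \<psi>)
  from "3.IH" obtain b c where "bounded_in M \<phi> b" "bounded_in M \<psi> c" by blast
  then have "bounded_in M (Plus \<phi> \<psi>) (b + c)"
    unfolding bounded_in_def eval.simps by (meson abs_triangle_ineq add_mono order_trans)
  moreover have "\<exists>\<delta>>0. close_in M (Plus \<phi> \<psi>) \<delta> \<epsilon>" if \<epsilon>: "\<epsilon> > 0" for \<epsilon>
  proof -
    obtain \<delta> where d1: "\<delta> > 0" "close_in M \<phi> \<delta> (\<epsilon> / 2)"
      using "3.IH" half_gt_zero[OF \<epsilon>] by blast
    obtain \<delta>' where d2: "\<delta>' > 0" "close_in M \<psi> \<delta>' (\<epsilon> / 2)"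
      using "3.IH" half_gt_zero[OF \<epsilon>] by blast
    note d = d1(1) d2(1) d1(2) d2(2)
    have "close_in M (Plus \<phi> \<psi>) (min \<delta> \<delta>') \<epsilon>"
      unfolding close_in_def
    proof (intro allI impI)
      fix e e' assume e: "range e \<subseteq> carr M" "range e' \<subseteq> carr M"
        "\<forall>i\<in>fv (Plus \<phi> \<psi>). sdist M (e i) (e' i) < min \<delta> \<delta>'"
      then have "\<bar>eval M \<phi> e - eval M \<phi> e'\<bar> \<le> \<epsilon> / 2" "\<bar>eval M \<psi> e - eval M \<psi> e'\<bar> \<le> \<epsilon> / 2"
        using d(3,4) unfolding close_in_def by auto
      then show "\<bar>eval M (Plus \<phi> \<psi>) e - eval M (Plus \<phi> \<psi>) e'\<bar> \<le> \<epsilon>" unfolding eval.simps by linarith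
    qed
    then show ?thesis using d by (intro exI[of _ "min \<delta> \<delta>'"]) auto
  qed
  ultimately show ?case by blast
next
  case (4 \<phi> r)
  from "4.IH" obtain b where "bounded_in M \<phi> b" by blast
  then have "bounded_in M (Scale r \<phi>) (\<bar>of_rat r\<bar> * b)"
    unfolding bounded_in_def by (auto simp: abs_mult intro: mult_left_mono)
  moreover have "\<exists>\<delta>>0. close_in M (Scale r \<phi>) \<delta> \<epsilon>" if \<epsilon>: "\<epsilon> > 0" for \<epsilon>
  proof -
    \<comment> \<open>One more than the absolute value, so that the division is also possible for
      \<open>r = 0\<close>.\<close>
    let ?q = "\<bar>of_rat r\<bar> + 1 :: real"
    have q: "0 < ?q" by (rule add_nonneg_pos) auto
    obtain \<delta> where d: "\<delta> > 0" "close_in M \<phi> \<delta> (\<epsilon> / ?q)"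
      using "4.IH" divide_pos_pos[OF \<epsilon> add_nonneg_pos[OF abs_ge_zero zero_less_one, of "of_rat r"]] by blast
    have "close_in M (Scale r \<phi>) \<delta> \<epsilon>"
      unfolding close_in_def
    proof (intro allI impI)
      fix e e' assume e: "range e \<subseteq> carr M" "range e' \<subseteq> carr M"
        "\<forall>i\<in>fv (Scale r \<phi>). sdist M (e i) (e' i) < \<delta>"
      then have "\<bar>eval M \<phi> e - eval M \<phi> e'\<bar> \<le> \<epsilon> / ?q"
        using d(2) unfolding close_in_def by auto
      then have "\<bar>eval M \<phi> e - eval M \<phi> e'\<bar> * ?q \<le> \<epsilon>"
        using pos_le_divide_eq[OF q] by blast
      moreover have "\<bar>eval M (Scale r \<phi>) e - eval M (Scale r \<phi>) e'\<bar> = \<bar>eval M \<phi> e - eval M \<phi> e'\<bar> * \<bar>of_rat r\<bar>"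
        unfolding eval.simps abs_mult[symmetric] by (simp only: algebra_simps)
      moreover have "\<dots> \<le> \<bar>eval M \<phi> e - eval M \<phi> e'\<bar> * ?q" by (intro mult_left_mono) auto
      ultimately show "\<bar>eval M (Scale r \<phi>) e - eval M (Scale r \<phi>) e'\<bar> \<le> \<epsilon>" by linarith
    qed
    then show ?thesis using d by blast
  qed
  ultimately show ?case by blast
next
  case (5 \<phi> \<psi>)
  from "5.IH" obtain b c where "bounded_in M \<phi> b" "bounded_in M \<psi> c" by blast
  then have "bounded_in M (Maxi \<phi> \<psi>) (max b c)"
    unfolding bounded_in_def eval.simps by (smt (verit, best))
  moreover have "\<exists>\<delta>>0. close_in M (Maxi \<phi> \<psi>) \<delta> \<epsilon>" if \<epsilon>: "\<epsilon> > 0" for \<epsilon>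
  proof -
    obtain \<delta> where d1: "\<delta> > 0" "close_in M \<phi> \<delta> \<epsilon>" using "5.IH" \<epsilon> by blast
    obtain \<delta>' where d2: "\<delta>' > 0" "close_in M \<psi> \<delta>' \<epsilon>" using "5.IH" \<epsilon> by blast
    note d = d1(1) d2(1) d1(2) d2(2)
    have "close_in M (Maxi \<phi> \<psi>) (min \<delta> \<delta>') \<epsilon>"
      unfolding close_in_def
    proof (intro allI impI)
      fix e e' assume e: "range e \<subseteq> carr M" "range e' \<subseteq> carr M"
        "\<forall>i\<in>fv (Maxi \<phi> \<psi>). sdist M (e i) (e' i) < min \<delta> \<delta>'"
      then have "\<bar>eval M \<phi> e - eval M \<phi> e'\<bar> \<le> \<epsilon>" "\<bar>eval M \<psi> e - eval M \<psi> e'\<bar> \<le> \<epsilon>"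
        using d(3,4) unfolding close_in_def by auto
      then show "\<bar>eval M (Maxi \<phi> \<psi>) e - eval M (Maxi \<phi> \<psi>) e'\<bar> \<le> \<epsilon>" unfolding eval.simps by linarith
    qed
    then show ?thesis using d by (intro exI[of _ "min \<delta> \<delta>'"]) auto
  qed
  ultimately show ?case by blast
next
  case (6 \<phi>)
  from "6.IH" obtain b where b: "bounded_in M \<phi> b" by blast
  have "bounded_in M (Var_sup \<phi>) b"
    unfolding bounded_in_def eval.simps
  proof (intro allI impI abs_cSUP_le carr_nonempty)
    fix e :: "nat \<Rightarrow> real" and x assume "range e \<subseteq> carr M" "x \<in> carr M"
    from case_nat_carr[OF this] show "\<bar>eval M \<phi> (case_nat x e)\<bar> \<le> b"
      using b unfolding bounded_in_def by blast
  qed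
  moreover have "close_in M (Var_sup \<phi>) \<delta> \<epsilon>" if "\<delta> > 0" "close_in M \<phi> \<delta> \<epsilon>" for \<delta> \<epsilon>
    unfolding close_in_def eval.simps
  proof (intro allI impI cSUP_close bdd_image_Var[OF b] carr_nonempty)
    fix e e' x assume "range e \<subseteq> carr M" "range e' \<subseteq> carr M"
      "\<forall>i\<in>fv (Var_sup \<phi>). sdist M (e i) (e' i) < \<delta>" "x \<in> carr M"
    then show "\<bar>eval M \<phi> (case_nat x e) - eval M \<phi> (case_nat x e')\<bar> \<le> \<epsilon>"
      using that by (intro close_in_case_nat) auto
  qed
  ultimately show ?case using "6.IH" by blast
next
  case (7 \<phi>)
  from "7.IH" obtain b where b: "bounded_in M \<phi> b" by blast
  have "bounded_in M (Var_inf \<phi>) b"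
    unfolding bounded_in_def eval.simps
  proof (intro allI impI abs_cSUP_le carr_nonempty)
    fix e :: "nat \<Rightarrow> real" and x assume "range e \<subseteq> carr M" "x \<in> carr M"
    from case_nat_carr[OF this] show "\<bar>eval M \<phi> (case_nat x e)\<bar> \<le> b"
      using b unfolding bounded_in_def by blast
  qed
  moreover have "close_in M (Var_inf \<phi>) \<delta> \<epsilon>" if "\<delta> > 0" "close_in M \<phi> \<delta> \<epsilon>" for \<delta> \<epsilon>
    unfolding close_in_def eval.simps
  proof (intro allI impI cINF_close bdd_image_Var[OF b] carr_nonempty)
    fix e e' x assume "range e \<subseteq> carr M" "range e' \<subseteq> carr M"
      "\<forall>i\<in>fv (Var_inf \<phi>). sdist M (e i) (e' i) < \<delta>" "x \<in> carr M"
    then show "\<bar>eval M \<phi> (case_nat x e) - eval M \<phi> (case_nat x e')\<bar> \<le> \<epsilon>"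
      using that by (intro close_in_case_nat) auto
  qed
  ultimately show ?case using "7.IH" by blast
next
  case (8 f)
  then obtain X \<Delta> lo hi where f: "is_modulus \<Delta>" "\<And>n. fm_respects L (f n) \<Delta> lo hi"
      "\<And>n. fv (f n) = X" "finite X"
    unfolding combinable_def by metis
  obtain b where b: "\<And>n. bounded_in M (f n) b"
    using fm_respects_bounded_close(1)[of \<Delta> f lo hi X] f by blast
  have "bounded_in M (Count_sup f) b"
    unfolding bounded_in_def eval.simps
    using b by (intro allI impI abs_cSUP_le) (auto simp: bounded_in_def)
  moreover have "\<exists>\<delta>>0. close_in M (Count_sup f) \<delta> \<epsilon>" if \<epsilon>: "\<epsilon> > 0" for \<epsilon>
  proof -
    obtain \<delta> where d: "\<delta> > 0" "\<And>n. close_in M (f n) \<delta> \<epsilon>"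
      using fm_respects_bounded_close(2)[of \<Delta> f lo hi X] f \<epsilon> by blast
    have "close_in M (Count_sup f) \<delta> \<epsilon>"
      unfolding close_in_def eval.simps
      using d(2) by (intro allI impI cSUP_close bdd_image_Count[OF b]) (auto simp: close_in_def)
    then show ?thesis using d(1) by blast
  qed
  ultimately show ?case by blast
next
  case (9 f)
  then obtain X \<Delta> lo hi where f: "is_modulus \<Delta>" "\<And>n. fm_respects L (f n) \<Delta> lo hi"
      "\<And>n. fv (f n) = X" "finite X"
    unfolding combinable_def by metis
  obtain b where b: "\<And>n. bounded_in M (f n) b"
    using fm_respects_bounded_close(1)[of \<Delta> f lo hi X] f by blast
  have "bounded_in M (Count_inf f) b"
    unfolding bounded_in_def eval.simps
    using b by (intro allI impI abs_cSUP_le) (auto simp: bounded_in_def)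
  moreover have "\<exists>\<delta>>0. close_in M (Count_inf f) \<delta> \<epsilon>" if \<epsilon>: "\<epsilon> > 0" for \<epsilon>
  proof -
    obtain \<delta> where d: "\<delta> > 0" "\<And>n. close_in M (f n) \<delta> \<epsilon>"
      using fm_respects_bounded_close(2)[of \<Delta> f lo hi X] f \<epsilon> by blast
    have "close_in M (Count_inf f) \<delta> \<epsilon>"
      unfolding close_in_def eval.simps
      using d(2) by (intro allI impI cINF_close bdd_image_Count[OF b]) (auto simp: close_in_def)
    then show ?thesis using d(1) by blast
  qed
  ultimately show ?case by blast
qed

lemma formula_bounded: "\<phi> \<in> formulas L \<Longrightarrow> \<exists>b. bounded_in M \<phi> b"
  and formula_close: "\<phi> \<in> formulas L \<Longrightarrow> \<epsilon> > 0 \<Longrightarrow> \<exists>\<delta>>0. close_in M \<phi> \<delta> \<epsilon>"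
  using formula_bounded_close by blast+

lemma openin_eval_less:
  assumes \<phi>: "\<phi> \<in> formulas L"
  shows "openin T {y \<in> tail_dense M. eval M \<phi> y < r}"
  unfolding openin_T_iff
proof (intro conjI ballI)
  fix y assume "y \<in> {y \<in> tail_dense M. eval M \<phi> y < r}"
  then have y: "y \<in> tail_dense M" "eval M \<phi> y < r" by auto
  define \<epsilon> where "\<epsilon> = (r - eval M \<phi> y) / 2"
  have "\<epsilon> > 0" using y by (simp add: \<epsilon>_def)
  then obtain \<delta> where d: "\<delta> > 0" "close_in M \<phi> \<delta> \<epsilon>" using formula_close[OF \<phi>] by blast
  obtain m where m: "fv \<phi> \<subseteq> {..<m}" using \<phi> by (rule fv_bounded)
  have "tuple_ball M (map y [0..<m]) \<delta> \<subseteq> {y \<in> tail_dense M. eval M \<phi> y < r}"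
  proof
    fix z assume z: "z \<in> tuple_ball M (map y [0..<m]) \<delta>"
    then have zt: "z \<in> tail_dense M" by (simp add: tuple_ball_def)
    have "range z \<subseteq> carr M" "range y \<subseteq> carr M"
      using tail_dense_carr[OF zt] tail_dense_carr[OF y(1)] by auto
    moreover have "\<forall>i\<in>fv \<phi>. sdist M (z i) (y i) < \<delta>"
      using z m by (auto simp: tuple_ball_def)
    ultimately have "\<bar>eval M \<phi> z - eval M \<phi> y\<bar> \<le> \<epsilon>"
      using d(2) unfolding close_in_def by blast
    from abs_le_D1[OF this] have "eval M \<phi> z < r"
      using y(2) unfolding \<epsilon>_def by (simp add: field_simps)
    then show "z \<in> {y \<in> tail_dense M. eval M \<phi> y < r}" using zt by simp
  qed
  then show "\<exists>m e. 0 < e \<and> tuple_ball M (map y [0..<m]) e \<subseteq> {y \<in> tail_dense M. eval M \<phi> y < r}"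
    using d(1) by blast
qed auto

end

section \<open>Codes and the topology of a fragment\<close>

context separable_structure
begin

text \<open>Uniform continuity in the bound variable: any \<open>x\<close> is approximated by some
  \<open>y j\<close>. This makes quantifiers visible in the code.\<close>

lemma SUP_tail_dense:
  assumes \<phi>: "\<phi> \<in> formulas L" and y: "y \<in> tail_dense M" and e: "range e \<subseteq> carr M"
  shows "(SUP x\<in>carr M. eval M \<phi> (case_nat x e)) = (SUP j. eval M \<phi> (case_nat (y j) e))"
proof (rule antisym)
  obtain b where b: "bounded_in M \<phi> b" using formula_bounded[OF \<phi>] by blast
  note bdd = bdd_image_Var(1)[OF b e]
  have sub: "range (\<lambda>j. eval M \<phi> (case_nat (y j) e)) \<subseteq> (\<lambda>x. eval M \<phi> (case_nat x e)) ` carr M"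
    using tail_dense_carr[OF y] by auto
  show "(SUP j. eval M \<phi> (case_nat (y j) e)) \<le> (SUP x\<in>carr M. eval M \<phi> (case_nat x e))"
    by (rule cSup_subset_mono[OF _ bdd sub]) simp
  show "(SUP x\<in>carr M. eval M \<phi> (case_nat x e)) \<le> (SUP j. eval M \<phi> (case_nat (y j) e))"
  proof (rule cSUP_least[OF carr_nonempty], rule field_le_epsilon)
    fix x and \<epsilon> :: real assume x: "x \<in> carr M" and "\<epsilon> > 0"
    then obtain \<delta> where d: "\<delta> > 0" "close_in M \<phi> \<delta> \<epsilon>" using formula_close[OF \<phi>] by blast
    then obtain j where j: "sdist M x (y j) < \<delta>" using y x unfolding tail_dense_iff by blast
    have "sdist M (case_nat x e i) (case_nat (y j) e i) < \<delta>" for i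
      using j d(1) e zero[of "e (i - 1)" "e (i - 1)"] by (cases i) (auto simp: image_subset_iff)
    then have "\<bar>eval M \<phi> (case_nat x e) - eval M \<phi> (case_nat (y j) e)\<bar> \<le> \<epsilon>"
      using d(2) case_nat_carr[OF e x] case_nat_carr[OF e tail_dense_carr[OF y, of j]]
      unfolding close_in_def by blast
    moreover have "eval M \<phi> (case_nat (y j) e) \<le> (SUP j. eval M \<phi> (case_nat (y j) e))"
      using bdd_above_mono[OF bdd sub] by (intro cSUP_upper) auto
    ultimately show "eval M \<phi> (case_nat x e) \<le> (SUP j. eval M \<phi> (case_nat (y j) e)) + \<epsilon>"
      by linarith
  qed
qed

lemma INF_tail_dense:
  assumes \<phi>: "\<phi> \<in> formulas L" and y: "y \<in> tail_dense M" and e: "range e \<subseteq> carr M"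
  shows "(INF x\<in>carr M. eval M \<phi> (case_nat x e)) = (INF j. eval M \<phi> (case_nat (y j) e))"
  using SUP_tail_dense[OF formulas.intros(4)[OF \<phi>, of "-1"] y e]
  unfolding cINF_eq_uminus_cSUP by simp

lemma code_of_in_Mod: "y \<in> tail_dense M \<Longrightarrow> code_of L M y \<in> Mod L"
  unfolding Mod_def presents_def using struct by (intro CollectI exI[of _ "(M, y)"]) simp

end

text \<open>The value of a formula at distinguished points depends on the code only, since quantifiers may
  be restricted to the dense sequence; no isomorphism of presentations has to be constructed.\<close>

lemma eval_code_cong:
  assumes "\<phi> \<in> formulas L" and M: "separable_structure L M y" and M': "separable_structure L M' y'"
    and code: "code_of L M y = code_of L M' y'"
  shows "eval M \<phi> (\<lambda>i. y (\<sigma> i)) = eval M' \<phi> (\<lambda>i. y' (\<sigma> i))"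
  using assms(1)
proof (induction arbitrary: \<sigma> rule: formulas.induct)
  case (1 i xs)
  have "code_of L M y i (map \<sigma> xs) = code_of L M' y' i (map \<sigma> xs)" by (simp add: code)
  then show ?case using 1 by (simp add: code_of_def comp_def)
next
  case (6 \<phi>)
  interpret M: separable_structure L M y by (rule M)
  interpret M': separable_structure L M' y' by (rule M')
  \<comment> \<open>Binding a distinguished point changes the index map to
    \<open>case_nat j \<sigma>\<close>; for this reason the induction is over all
    \<open>\<sigma>\<close>.\<close>
  have shift: "case_nat (z j) (\<lambda>i. z (\<sigma> i)) = (\<lambda>i. z (case_nat j \<sigma> i))" for z :: "nat \<Rightarrow> real" and j
    by (auto simp: fun_eq_iff split: nat.split)
  have "range (\<lambda>i. y (\<sigma> i)) \<subseteq> carr M" "range (\<lambda>i. y' (\<sigma> i)) \<subseteq> carr M'"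
    using M.tail_dense_carr[OF M.y0] M'.tail_dense_carr[OF M'.y0] by auto
  then show ?case
    unfolding eval.simps using M.SUP_tail_dense[OF 6(1) M.y0] M'.SUP_tail_dense[OF 6(1) M'.y0]
    by (simp add: shift 6(2))
next
  case (7 \<phi>)
  interpret M: separable_structure L M y by (rule M)
  interpret M': separable_structure L M' y' by (rule M')
  have shift: "case_nat (z j) (\<lambda>i. z (\<sigma> i)) = (\<lambda>i. z (case_nat j \<sigma> i))" for z :: "nat \<Rightarrow> real" and j
    by (auto simp: fun_eq_iff split: nat.split)
  have "range (\<lambda>i. y (\<sigma> i)) \<subseteq> carr M" "range (\<lambda>i. y' (\<sigma> i)) \<subseteq> carr M'"
    using M.tail_dense_carr[OF M.y0] M'.tail_dense_carr[OF M'.y0] by auto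
  then show ?case
    unfolding eval.simps using M.INF_tail_dense[OF 7(1) M.y0] M'.INF_tail_dense[OF 7(1) M'.y0]
    by (simp add: shift 7(2))
qed simp_all

text \<open>Variables are read off the whole distinguished sequence, so a tuple of parameters
  becomes a substitution.\<close>

definition val :: "signature \<Rightarrow> code \<Rightarrow> fm \<Rightarrow> real" where
  "val L N \<phi> = eval (str L N) \<phi> (snd (pres L N))"

definition neg_set :: "signature \<Rightarrow> fm \<Rightarrow> code set" where
  "neg_set L \<phi> = {N \<in> Mod L. val L N \<phi> < 0}"

definition zero_set :: "signature \<Rightarrow> fm \<Rightarrow> code set" where
  "zero_set L \<phi> = {N \<in> Mod L. val L N \<phi> = 0}"

lemma presents_pres: "N \<in> Mod L \<Longrightarrow> presents L (pres L N) N"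
  unfolding Mod_def pres_def by (auto intro: someI)

lemma separable_structure_str:
  "is_signature L \<Longrightarrow> N \<in> Mod L \<Longrightarrow> separable_structure L (str L N) (snd (pres L N))"
  using presents_pres[of N L] by (simp add: separable_structure_def presents_def str_def)

text \<open>The presentation chosen by \<open>pres\<close> has the same code as \<open>M\<close>
  with \<open>y\<close>, hence the same values.\<close>

lemma (in separable_structure) val_code_of:
  assumes "\<phi> \<in> formulas L" "y \<in> tail_dense M"
  shows "val L (code_of L M y) \<phi> = eval M \<phi> y"
proof -
  let ?N = "code_of L M y"
  have N: "?N \<in> Mod L" using assms(2) by (rule code_of_in_Mod)
  have "separable_structure L M y" using sig struct assms(2) by unfold_locales
  moreover have "code_of L (str L ?N) (snd (pres L ?N)) = ?N"
    using presents_pres[OF N] by (simp add: presents_def str_def)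
  ultimately show ?thesis
    unfolding val_def using eval_code_cong[OF assms(1) separable_structure_str[OF sig N], of M y "\<lambda>i. i"] by simp
qed

text \<open>This is the preimage of \<open>A\<close> under \<open>\<pi>\<close>.\<close>

definition coded_in :: "signature \<Rightarrow> 'a mstruct \<Rightarrow> code set \<Rightarrow> (nat \<Rightarrow> 'a) set" where
  "coded_in L M A = {y \<in> tail_dense M. code_of L M y \<in> A}"

lemma (in separable_structure) coded_in_simps:
  shows coded_in_neg_set: "\<phi> \<in> formulas L \<Longrightarrow> coded_in L M (neg_set L \<phi>) = {y \<in> tail_dense M. eval M \<phi> y < 0}"
    and coded_in_zero_set: "\<phi> \<in> formulas L \<Longrightarrow> coded_in L M (zero_set L \<phi>) = {y \<in> tail_dense M. eval M \<phi> y = 0}"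
    and coded_in_UN: "coded_in L M (\<Union>i\<in>I. A i) = (\<Union>i\<in>I. coded_in L M (A i))"
    and coded_in_INT: "coded_in L M (\<Inter>i. B i) = (\<Inter>i. coded_in L M (B i))"
    and coded_in_diff: "coded_in L M (Mod L - A') = tail_dense M - coded_in L M A'"
  using code_of_in_Mod by (auto simp: coded_in_def neg_set_def zero_set_def val_code_of)

section \<open>Borel classes of the fragment topology\<close>

locale fragment =
  fixes L :: signature and F :: "fm set"
  assumes sig: "is_signature L" and frag: "is_fragment L F"
begin

lemma F_formulas: "\<phi> \<in> F \<Longrightarrow> \<phi> \<in> formulas L"
  using frag by (auto simp: is_fragment_def)

lemma F_closed [intro, simp]:
  "Unit \<in> F" "\<phi> \<in> F \<Longrightarrow> \<psi> \<in> F \<Longrightarrow> Plus \<phi> \<psi> \<in> F" "\<phi> \<in> F \<Longrightarrow> \<psi> \<in> F \<Longrightarrow> Maxi \<phi> \<psi> \<in> F"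
  "\<phi> \<in> F \<Longrightarrow> Scale r \<phi> \<in> F" "\<phi> \<in> F \<Longrightarrow> Var_sup \<phi> \<in> F" "\<phi> \<in> F \<Longrightarrow> subst \<phi> \<sigma> \<in> F"
  using frag by (auto simp: is_fragment_def)

lemma dist_in_F: "Atom 0 [i, j] \<in> F"
  using frag sig by (auto simp: is_fragment_def is_signature_def)

text \<open>The sets \<open>neg_set L \<phi>\<close> form a base: \<open>Maxi\<close> gives finite
  intersections, substitution absorbs parameters, and a rational bound is absorbed by subtracting a
  constant formula.\<close>

lemma openin_t_top_iff: "openin (t_top L F) U \<longleftrightarrow> (\<exists>\<Phi>\<subseteq>F. U = (\<Union>\<phi>\<in>\<Phi>. neg_set L \<phi>))"
proof
  assume "openin (t_top L F) U"
  then have "generate_topology_on {{N \<in> Mod L. evalt (str L N) \<phi> (pts L N js) < of_rat r} | \<phi> js r.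
        \<phi> \<in> F \<and> fv \<phi> \<subseteq> {..<length js}} U"
    by (simp add: t_top_def openin_topology_generated_by_iff)
  then show "\<exists>\<Phi>\<subseteq>F. U = (\<Union>\<phi>\<in>\<Phi>. neg_set L \<phi>)"
  proof induction
    case Empty
    show ?case by (intro exI[of _ "{}"]) auto
  next
    case (Int a b)
    then obtain \<Phi> \<Psi> where *: "\<Phi> \<subseteq> F" "\<Psi> \<subseteq> F" "a = (\<Union>\<phi>\<in>\<Phi>. neg_set L \<phi>)" "b = (\<Union>\<phi>\<in>\<Psi>. neg_set L \<phi>)"
      by blast
    have "neg_set L (Maxi \<phi> \<psi>) = neg_set L \<phi> \<inter> neg_set L \<psi>" for \<phi> \<psi>
      by (auto simp: neg_set_def val_def)
    then have "a \<inter> b = (\<Union>\<phi>\<in>{Maxi \<phi> \<psi> | \<phi> \<psi>. \<phi> \<in> \<Phi> \<and> \<psi> \<in> \<Psi>}. neg_set L \<phi>)"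
      unfolding *(3,4) by fastforce
    moreover have "{Maxi \<phi> \<psi> | \<phi> \<psi>. \<phi> \<in> \<Phi> \<and> \<psi> \<in> \<Psi>} \<subseteq> F" using *(1,2) by auto
    ultimately show ?case by blast
  next
    case (UN K)
    have "\<forall>k\<in>K. \<exists>\<Phi>. \<Phi> \<subseteq> F \<and> (\<Union>\<phi>\<in>\<Phi>. neg_set L \<phi>) = k"
    proof
      fix k assume "k \<in> K"
      from UN.IH[OF this] obtain \<Phi> where "\<Phi> \<subseteq> F" "k = (\<Union>\<phi>\<in>\<Phi>. neg_set L \<phi>)" by blast
      then show "\<exists>\<Phi>. \<Phi> \<subseteq> F \<and> (\<Union>\<phi>\<in>\<Phi>. neg_set L \<phi>) = k" by (intro exI[of _ \<Phi>]) simp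
    qed
    from bchoice[OF this] obtain \<Phi>
      where *: "\<forall>k\<in>K. \<Phi> k \<subseteq> F \<and> (\<Union>\<phi>\<in>\<Phi> k. neg_set L \<phi>) = k" ..
    then have \<Phi>: "\<And>k. k \<in> K \<Longrightarrow> \<Phi> k \<subseteq> F" "\<And>k. k \<in> K \<Longrightarrow> (\<Union>\<phi>\<in>\<Phi> k. neg_set L \<phi>) = k"
      by blast+
    have "\<Union>K = (\<Union>k\<in>K. \<Union>\<phi>\<in>\<Phi> k. neg_set L \<phi>)" using \<Phi>(2) by simp
    also have "\<dots> = (\<Union>\<phi>\<in>(\<Union>k\<in>K. \<Phi> k). neg_set L \<phi>)" by simp
    finally have "\<Union>K = (\<Union>\<phi>\<in>(\<Union>k\<in>K. \<Phi> k). neg_set L \<phi>)" .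
    moreover have "(\<Union>k\<in>K. \<Phi> k) \<subseteq> F" using \<Phi>(1) by auto
    ultimately show ?case by blast
  next
    case (Basis s)
    then obtain \<phi> js r where s: "s = {N \<in> Mod L. evalt (str L N) \<phi> (pts L N js) < of_rat r}"
        "\<phi> \<in> F" "fv \<phi> \<subseteq> {..<length js}" by auto
    have "evalt (str L N) \<phi> (pts L N js) = val L N (subst \<phi> (\<lambda>i. js ! i))" for N
      unfolding val_def eval_subst using s(3) by (intro evalt_eq_eval) (auto simp: pts_def)
    then have "s = neg_set L (Plus (subst \<phi> (\<lambda>i. js ! i)) (Scale (- r) Unit))"
      unfolding s(1) neg_set_def val_def by (simp add: of_rat_minus)
    then show ?case using s(2) by (intro exI[of _ "{Plus (subst \<phi> (\<lambda>i. js ! i)) (Scale (- r) Unit)}"]) auto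
  qed
next
  assume "\<exists>\<Phi>\<subseteq>F. U = (\<Union>\<phi>\<in>\<Phi>. neg_set L \<phi>)"
  then obtain \<Phi> where \<Phi>: "\<Phi> \<subseteq> F" "U = (\<Union>\<phi>\<in>\<Phi>. neg_set L \<phi>)" by blast
  have "openin (t_top L F) (neg_set L \<phi>)" if \<phi>: "\<phi> \<in> F" for \<phi>
  proof -
    obtain m where m: "fv \<phi> \<subseteq> {..<m}" using fv_bounded[OF F_formulas[OF \<phi>]] by blast
    have "evalt (str L N) \<phi> (pts L N [0..<m]) = val L N \<phi>" for N
      unfolding val_def using m by (intro evalt_eq_eval) (auto simp: pts_def)
    then have "neg_set L \<phi> = {N \<in> Mod L. evalt (str L N) \<phi> (pts L N [0..<m]) < of_rat 0}"
      by (simp add: neg_set_def)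
    then show ?thesis
      unfolding t_top_def using \<phi> m by (intro topology_generated_by_Basis) fastforce
  qed
  then show "openin (t_top L F) U" unfolding \<Phi>(2) using \<Phi>(1) by blast
qed

lemma openin_neg_set: "\<phi> \<in> F \<Longrightarrow> openin (t_top L F) (neg_set L \<phi>)"
  unfolding openin_t_top_iff by (intro exI[of _ "{\<phi>}"]) auto

lemma topspace_t_top: "topspace (t_top L F) = Mod L"
proof
  show "topspace (t_top L F) \<subseteq> Mod L"
    using openin_topspace[of "t_top L F"] unfolding openin_t_top_iff by (auto simp: neg_set_def)
  have "neg_set L (Scale (- 1) Unit) = Mod L" by (auto simp: neg_set_def val_def)
  then show "Mod L \<subseteq> topspace (t_top L F)"
    using openin_neg_set[of "Scale (- 1) Unit"] openin_subset by auto
qed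

lemma open_countable_neg_sets:
  assumes "openin (t_top L F) U"
  obtains \<psi> :: "nat \<Rightarrow> fm" where "\<And>n. \<psi> n \<in> F" "U = (\<Union>n. neg_set L (\<psi> n))"
proof -
  obtain \<Phi> where \<Phi>: "\<Phi> \<subseteq> F" "U = (\<Union>\<phi>\<in>\<Phi>. neg_set L \<phi>)" using assms unfolding openin_t_top_iff by blast
  \<comment> \<open>\<open>Unit\<close> keeps the set to be enumerated nonempty; having the value 1,
    it contributes no code.\<close>
  have "countable (insert Unit \<Phi>)"
    using \<Phi>(1) frag countable_subset by (auto simp: is_fragment_def)
  then have r: "range (from_nat_into (insert Unit \<Phi>)) = insert Unit \<Phi>" by (intro range_from_nat_into) auto
  have "neg_set L Unit = {}" by (auto simp: neg_set_def val_def)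
  then have "U = (\<Union>\<phi>\<in>insert Unit \<Phi>. neg_set L \<phi>)" using \<Phi>(2) by auto
  then have "U = (\<Union>n. neg_set L (from_nat_into (insert Unit \<Phi>) n))" by (subst (asm) r[symmetric]) auto
  moreover have "from_nat_into (insert Unit \<Phi>) n \<in> F" for n
    using r \<Phi>(1) by (metis F_closed(1) insert_subset rangeI subsetD)
  ultimately show thesis by (intro that[of "from_nat_into (insert Unit \<Phi>)"])
qed

text \<open>\<open>x < 0\<close> iff \<open>max (x + 1 / (k + 1)) 0\<close> vanishes for some
  \<open>k\<close>. This serves twice: families of rank -1 can only test for zero, and monotonicity
  of the Borel classes rests on open sets being countable unions of closed ones.\<close>

lemma open_countable_zero_sets:
  assumes "openin (t_top L F) U"
  obtains \<psi> :: "nat \<Rightarrow> fm" where "\<And>n. \<psi> n \<in> F" "U = (\<Union>n. zero_set L (\<psi> n))"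
proof -
  obtain \<psi> :: "nat \<Rightarrow> fm" where \<psi>: "\<And>n. \<psi> n \<in> F" "U = (\<Union>n. neg_set L (\<psi> n))"
    using assms by (rule open_countable_neg_sets) auto
  define z where "z n k = Maxi (Plus (\<psi> n) (Scale (1 / of_nat (Suc k)) Unit)) (Scale 0 Unit)" for n k
  have "neg_set L (\<psi> n) = (\<Union>k. zero_set L (z n k))" for n
  proof -
    have "x < 0 \<longleftrightarrow> (\<exists>k. max (x + 1 / real (Suc k)) 0 = 0)" for x :: real
    proof
      assume "x < 0"
      then obtain k where "inverse (real (Suc k)) < - x" using reals_Archimedean[of "- x"] by auto
      then show "\<exists>k. max (x + 1 / real (Suc k)) 0 = 0"
        by (intro exI[of _ k]) (simp add: inverse_eq_divide max_def)
    next
      assume "\<exists>k. max (x + 1 / real (Suc k)) 0 = 0"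
      then obtain k where "x + 1 / real (Suc k) \<le> 0" by (metis max.cobounded1)
      moreover have "1 / real (Suc k) > 0" by simp
      ultimately show "x < 0" by linarith
    qed
    then show ?thesis
      by (auto simp: neg_set_def zero_set_def val_def z_def of_rat_divide simp del: of_nat_Suc)
  qed
  then have "U = (\<Union>n. \<Union>k. zero_set L (z n k))" by (simp add: \<psi>(2))
  also have "\<dots> = (\<Union>q. zero_set L (case prod_decode q of (n, k) \<Rightarrow> z n k))"
  proof (intro equalityI subsetI)
    fix N assume "N \<in> (\<Union>n. \<Union>k. zero_set L (z n k))"
    then obtain n k where "N \<in> zero_set L (z n k)" by blast
    then show "N \<in> (\<Union>q. zero_set L (case prod_decode q of (n, k) \<Rightarrow> z n k))"
      by (intro UN_I[of "prod_encode (n, k)"]) auto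
  next
    fix N assume "N \<in> (\<Union>q. zero_set L (case prod_decode q of (n, k) \<Rightarrow> z n k))"
    then obtain q where "N \<in> zero_set L (case prod_decode q of (n, k) \<Rightarrow> z n k)" by blast
    then show "N \<in> (\<Union>n. \<Union>k. zero_set L (z n k))" by (cases "prod_decode q") auto
  qed
  finally have "U = (\<Union>q. zero_set L (case prod_decode q of (n, k) \<Rightarrow> z n k))" .
  moreover have "(case prod_decode q of (n, k) \<Rightarrow> z n k) \<in> F" for q
    using \<psi>(1) by (auto simp: z_def split: prod.split)
  ultimately show thesis by (intro that[of "\<lambda>q. case prod_decode q of (n, k) \<Rightarrow> z n k"])
qed

lemma Pi0_zero_set:
  assumes "\<phi> \<in> F" shows "Pi0 (t_top L F) 1 (zero_set L \<phi>)"
proof -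
  have "zero_set L \<phi> = topspace (t_top L F) - (neg_set L \<phi> \<union> neg_set L (Scale (- 1) \<phi>))"
    by (auto simp: topspace_t_top zero_set_def neg_set_def val_def)
  then show ?thesis
    using assms by (simp only:) (intro compl_Pi0 open_Sigma0 openin_Un openin_neg_set F_closed)
qed

text \<open>An open set splits into zero sets, whose class 1 is below \<open>\<xi>\<close>;
  otherwise the definition gives pieces of class below \<open>\<zeta>\<close>.\<close>

lemma Sigma0_as_Union:
  assumes "Sigma0 (t_top L F) \<zeta> B" "\<zeta> \<le> \<xi>" "1 < \<xi>"
  obtains \<theta> C where "\<And>n::nat. 1 \<le> \<theta> n" "\<And>n. \<theta> n < \<xi>" "\<And>n. Pi0 (t_top L F) (\<theta> n) (C n)" "B = (\<Union>n. C n)"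
  using assms(1)
proof cases
  case open_Sigma0
  show thesis
  proof (rule open_countable_zero_sets[OF open_Sigma0(2)])
    fix \<psi> :: "nat \<Rightarrow> fm" assume "\<And>n. \<psi> n \<in> F" "B = (\<Union>n. zero_set L (\<psi> n))"
    then show thesis
      using assms(3) by (intro that[of "\<lambda>_. 1" "\<lambda>n. zero_set L (\<psi> n)"] Pi0_zero_set) auto
  qed
next
  case (Union_Sigma0 \<theta> C)
  then show thesis
    using assms(2) by (intro that[of \<theta> C]) (auto intro: less_le_trans)
qed

lemma Sigma0_subset: "Sigma0 (t_top L F) \<zeta> B \<Longrightarrow> B \<subseteq> Mod L"
  and Pi0_subset: "Pi0 (t_top L F) \<zeta> B \<Longrightarrow> B \<subseteq> Mod L"
proof (induction rule: Sigma0_Pi0.inducts)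
  case (open_Sigma0 U)
  then show ?case using openin_subset topspace_t_top by blast
qed (auto simp: topspace_t_top)

lemma Pi0_as_Inter:
  assumes "Pi0 (t_top L F) \<xi> A" "1 < \<xi>"
  obtains \<zeta> B where "\<And>n::nat. 1 \<le> \<zeta> n" "\<And>n. \<zeta> n < \<xi>" "\<And>n. Sigma0 (t_top L F) (\<zeta> n) (B n)" "A = (\<Inter>n. B n)"
proof -
  obtain U where U: "Sigma0 (t_top L F) \<xi> U" "A = Mod L - U"
    using assms(1) by cases (auto simp: topspace_t_top)
  then obtain \<zeta> D where D: "\<And>n::nat. 1 \<le> \<zeta> n \<and> \<zeta> n < \<xi> \<and> Pi0 (t_top L F) (\<zeta> n) (D n)" "U = (\<Union>n. D n)"
    using U(1) assms(2) by cases auto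
  have "\<exists>B. Sigma0 (t_top L F) (\<zeta> n) B \<and> D n = Mod L - B" for n
    using D(1)[of n] by (auto elim!: Pi0.cases simp: topspace_t_top)
  then obtain B where B: "\<And>n. Sigma0 (t_top L F) (\<zeta> n) (B n)" "\<And>n. D n = Mod L - B n" by metis
  have "B n \<subseteq> Mod L" for n using Sigma0_subset[OF B(1)] .
  then have "A = (\<Inter>n. B n)" unfolding U(2) D(2) B(2) by blast
  then show thesis using D(1) B(1) by (intro that[of \<zeta> B]) auto
qed

text \<open>A constant union followed by a complement. It turns the Sigma factors of a limit stage
  into Pi sets.\<close>

lemma Sigma0_imp_Pi0_osuc:
  assumes "Sigma0 (t_top L F) \<zeta> B" "1 \<le> \<zeta>"
  shows "Pi0 (t_top L F) (osuc \<zeta>) B"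
proof -
  let ?T = "t_top L F"
  have "Sigma0 ?T (osuc \<zeta>) (\<Union>n::nat. topspace ?T - B)"
  proof (rule Union_Sigma0)
    show "1 < osuc \<zeta>" using assms(2) osuc_greater[of \<zeta>] by simp
    show "\<forall>n::nat. 1 \<le> \<zeta> \<and> \<zeta> < osuc \<zeta> \<and> Pi0 ?T \<zeta> (topspace ?T - B)"
      using assms osuc_greater compl_Pi0 by auto
  qed
  from compl_Pi0[OF this] show ?thesis
    using Sigma0_subset[OF assms(1)] by (simp add: topspace_t_top double_diff)
qed

lemma Pi0_mono:
  assumes "Pi0 (t_top L F) \<zeta> A" "\<zeta> \<le> \<xi>" "1 \<le> \<zeta>"
  shows "Pi0 (t_top L F) \<xi> A"
proof (cases "1 < \<xi>")
  case True
  obtain U where U: "Sigma0 (t_top L F) \<zeta> U" "A = topspace (t_top L F) - U" using assms(1) by cases auto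
  obtain \<theta> C where "\<And>n::nat. 1 \<le> \<theta> n" "\<And>n. \<theta> n < \<xi>" "\<And>n. Pi0 (t_top L F) (\<theta> n) (C n)" "U = (\<Union>n. C n)"
    using Sigma0_as_Union[OF U(1) assms(2) True] by blast
  then have "Sigma0 (t_top L F) \<xi> U" using Union_Sigma0[OF True, of \<theta> "t_top L F" C] by auto
  then show ?thesis unfolding U(2) by (rule compl_Pi0)
next
  case False
  then have "\<zeta> = \<xi>" using assms(2,3) by simp
  then show ?thesis using assms(1) by simp
qed

end

section \<open>Pulling Borel sets back to tail-dense sequences\<close>

locale fragment_structure = fragment L F + separable_structure L M y0 for L F M y0
begin

text \<open>Continuity of \<open>\<pi>\<close>, inherited from the continuity of formulas.\<close>

lemma openin_coded_in:
  assumes "openin (t_top L F) U" shows "openin T (coded_in L M U)"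
proof -
  obtain \<Phi> where \<Phi>: "\<Phi> \<subseteq> F" "U = (\<Union>\<phi>\<in>\<Phi>. neg_set L \<phi>)" using assms unfolding openin_t_top_iff by blast
  have "openin T (coded_in L M (neg_set L \<phi>))" if "\<phi> \<in> \<Phi>" for \<phi>
  proof -
    have "\<phi> \<in> formulas L" using that \<Phi>(1) F_formulas by blast
    then show ?thesis using openin_eval_less[of \<phi> 0] coded_in_neg_set[of \<phi>] by simp
  qed
  then show ?thesis unfolding \<Phi>(2) coded_in_UN by blast
qed

lemma locally_decided_coded_in:
  shows "Sigma0 (t_top L F) \<zeta> A \<Longrightarrow> locally_decided T (coded_in L M A)"
    and "Pi0 (t_top L F) \<zeta> A \<Longrightarrow> locally_decided T (coded_in L M A)"
proof (induction rule: Sigma0_Pi0.inducts)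
  case (open_Sigma0 U)
  then show ?case by (intro locally_decided_open openin_coded_in)
next
  case (Union_Sigma0 \<xi> \<zeta> A)
  then show ?case unfolding coded_in_UN by (intro locally_decided_UN_T) auto
next
  case (compl_Pi0 \<xi> U)
  then show ?case
    unfolding topspace_t_top coded_in_diff topspace_T[symmetric] by (intro locally_decided_diff)
qed

end

section \<open>Realization\<close>

lemma realizes_length: "realizes M P c \<Longrightarrow> length c = ae_len P"
  by (cases P) auto

context separable_structure
begin

text \<open>The sequence begins with \<open>c\<close>, continues with the entries of
  \<open>b\<close> past \<open>c\<close>, then with \<open>y0\<close>. As \<open>tdist\<close>
  compares only the common part, this handles either tuple being the longer one.\<close>

lemma tuple_ball_overwrite_append:
  assumes c: "c \<in> lists (carr M)" and b: "b \<in> lists (carr M)"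
    and "0 < v" "0 < w" "tdist M c b < v"
  shows "overwrite (c @ drop (length c) b) y0 \<in> tuple_ball M c w \<inter> tuple_ball M b v"
proof -
  let ?y = "overwrite (c @ drop (length c) b) y0"
  have "?y \<in> tail_dense M"
    using c b by (intro overwrite_tail_dense y0) (auto dest: in_set_dropD)
  moreover have "sdist M (?y i) (c ! i) < w" if "i < length c" for i
    using that c assms(4) zero[of "c ! i" "c ! i"] by (auto simp: overwrite_def nth_append in_lists_conv_set)
  moreover have "sdist M (?y i) (b ! i) < v" if i: "i < length b" for i
  proof (cases "i < length c")
    case True
    then show ?thesis
      using i assms(3,5) by (auto simp: overwrite_def nth_append tdist_less_iff)
  next
    case False
    then show ?thesis
      using i b assms(3) zero[of "b ! i" "b ! i"] by (auto simp: overwrite_def nth_append in_lists_conv_set)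
  qed
  ultimately show ?thesis by (auto simp: tuple_ball_def)
qed

lemma tdist_map_less:
  assumes "y \<in> tuple_ball M c w" "0 < w"
  shows "tdist M (map y [0..<m]) c < w"
  using assms by (auto simp: tdist_less_iff tuple_ball_def)

lemma map_in_lists: "y \<in> tail_dense M \<Longrightarrow> map y [0..<m] \<in> lists (carr M)"
  using tail_dense_carr by auto

lemma openin_T_carr: "openin T V \<Longrightarrow> y \<in> V \<Longrightarrow> y \<in> tail_dense M"
  using openin_subset topspace_T by blast

lemma residual_on_dense_open:
  assumes "openin T G" "\<And>W. openin T W \<Longrightarrow> W \<subseteq> V \<Longrightarrow> W \<noteq> {} \<Longrightarrow> W \<inter> G \<noteq> {}"
  shows "residual_on T V G"
  unfolding residual_on_def using assms by (intro exI[of _ "\<lambda>_. G"]) auto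

text \<open>Only common initial parts are compared, so \<open>b\<close> may be shorter than \<open>a\<close>; it is then
  continued by the remaining entries of \<open>a\<close>.\<close>

lemma test_tuple_open:
  assumes a: "a \<in> lists (carr M)" and b: "b \<in> lists (carr M)"
    and "0 < u" "0 < v" "tdist M b a < u"
  shows "openin T (tuple_ball M b v \<inter> tuple_ball M a u)" "tuple_ball M b v \<inter> tuple_ball M a u \<noteq> {}"
  using openin_tuple_ball[OF a] openin_tuple_ball[OF b] tuple_ball_overwrite_append[OF b a assms(3,4,5)]
  by auto

text \<open>Baire's theorem gives a point of \<open>O' k\<close> in each test set; its initial
  segment is a zero of some \<open>\<psi> k l\<close>. Conversely a realizing tuple, extended to a
  sequence, lands in \<open>O' k\<close>, and since \<open>O' k\<close> is open, density alone makes
  it residual. The index codes \<open>l\<close> and a length \<open>n + i\<close>; where this is too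
  short for \<open>\<psi> k l\<close>, \<open>Unit\<close> makes the member unrealizable.\<close>

lemma realizes_Block_Basic_iff:
  assumes a: "a \<in> lists (carr M)" "length a = n" and u: "0 < u"
    and \<psi>: "\<And>k l. \<psi> k l \<in> formulas L"
    and O: "\<And>k. openin T (O' k)" "\<And>k. O' k = (\<Union>l. {y \<in> tail_dense M. eval M (\<psi> k l) y = 0})"
  shows "residual_on T (tuple_ball M a u) (\<Inter>k. O' k) \<longleftrightarrow>
    realizes M (Block n u (\<lambda>k q. case prod_decode q of (l, i) \<Rightarrow>
      Basic (n + i) (if fv (\<psi> k l) \<subseteq> {..<n + i} then \<psi> k l else Unit))) a"
    (is "_ \<longleftrightarrow> realizes M (Block n u ?p) a")
proof
  assume res: "residual_on T (tuple_ball M a u) (\<Inter>k. O' k)"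
  have "\<exists>c\<in>lists (carr M). \<exists>q. tdist M c b < v \<and> realizes M (?p k q) c"
    if b: "b \<in> lists (carr M)" "tdist M b a < u" and v: "0 < v" for b v k
  proof -
    let ?V = "tuple_ball M b v \<inter> tuple_ball M a u"
    note V = test_tuple_open[OF a(1) b(1) u v b(2)]
    have "residual_on T ?V (O' k)" using res by (rule residual_on_mono) auto
    then have "?V \<inter> O' k \<noteq> {}" by (rule residual_on_nonempty[OF completely_metrizable_T V])
    then obtain y l where y: "y \<in> ?V" "y \<in> tail_dense M" "eval M (\<psi> k l) y = 0" unfolding O(2) by auto
    obtain m where m: "fv (\<psi> k l) \<subseteq> {..<m}" using fv_bounded[OF \<psi>] by blast
    \<comment> \<open>Length \<open>n + m\<close> covers the variables of \<open>\<psi> k l\<close>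
      and has the form \<open>n + i\<close> of the members.\<close>
    then have fv: "fv (\<psi> k l) \<subseteq> {..<n + m}" by auto
    have "evalt M (\<psi> k l) (map y [0..<n + m]) = eval M (\<psi> k l) y"
      using fv by (intro evalt_eq_eval) auto
    then have "realizes M (?p k (prod_encode (l, m))) (map y [0..<n + m])"
      using y(3) fv by simp
    then show ?thesis
      using map_in_lists[OF y(2)] tdist_map_less[OF _ v, of y b] y(1) by blast
  qed
  then show "realizes M (Block n u ?p) a" using a(2) by simp
next
  assume real: "realizes M (Block n u ?p) a"
  show "residual_on T (tuple_ball M a u) (\<Inter>k. O' k)"
  proof (intro residual_on_INT residual_on_dense_open O(1))
    fix k W assume W: "openin T W" "W \<subseteq> tuple_ball M a u" "W \<noteq> {}"
    then obtain y where y: "y \<in> W" by blast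
    obtain m e where e: "0 < e" "tuple_ball M (map y [0..<m]) e \<subseteq> W"
      using openin_T_tuple_ball_subset[OF W(1) y] by metis
    have b: "map y [0..<m] \<in> lists (carr M)" using openin_T_carr[OF W(1) y] by (rule map_in_lists)
    moreover have "tdist M (map y [0..<m]) a < u" using W(2) y u by (intro tdist_map_less) auto
    ultimately obtain c q where c: "c \<in> lists (carr M)" "tdist M c (map y [0..<m]) < e" "realizes M (?p k q) c"
      using real e(1) by fastforce
    obtain l i where q: "prod_decode q = (l, i)" by fastforce
    have fv: "fv (\<psi> k l) \<subseteq> {..<n + i}" "length c = n + i" "evalt M (\<psi> k l) c = 0"
      using c(3) by (auto simp: q evalt_def split: if_splits)
    let ?z = "overwrite (c @ drop (length c) (map y [0..<m])) y0"
    have z: "?z \<in> tuple_ball M (map y [0..<m]) e"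
      using tuple_ball_overwrite_append[OF c(1) b e(1) zero_less_one c(2)] by blast
    have "evalt M (\<psi> k l) c = eval M (\<psi> k l) ?z"
      using fv(1,2) by (intro evalt_eq_eval) (auto simp: overwrite_def nth_append)
    then have "?z \<in> O' k" unfolding O(2) using z fv(3) by (auto simp: tuple_ball_def)
    then show "W \<inter> O' k \<noteq> {}" using z e(2) by blast
  qed
qed

text \<open>The index \<open>q\<close> codes the piece \<open>S k l\<close> together with the length \<open>n + i\<close> and the radius
  \<open>u / (j + 1)\<close> of a ball on which this piece is to be residual.\<close>

lemma realizes_Block_iff:
  assumes a: "a \<in> lists (carr M)" "length a = n" and u: "0 < u"
    and dec: "\<And>k l. locally_decided T (S k l)"
    and p: "\<And>k l i j c. c \<in> lists (carr M) \<Longrightarrow> length c = n + i \<Longrightarrow>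
        realizes M (p k l i j) c \<longleftrightarrow> residual_on T (tuple_ball M c (u / real (Suc j))) (S k l)"
    and len: "\<And>k l i j. ae_len (p k l i j) = n + i"
  shows "residual_on T (tuple_ball M a u) (\<Inter>k. \<Union>l. S k l) \<longleftrightarrow>
    realizes M (Block n u (\<lambda>k q. case prod_decode q of (l, r) \<Rightarrow> case prod_decode r of (i, j) \<Rightarrow> p k l i j)) a"
    (is "_ \<longleftrightarrow> realizes M (Block n u ?p) a")
proof
  assume res: "residual_on T (tuple_ball M a u) (\<Inter>k. \<Union>l. S k l)"
  have "\<exists>c\<in>lists (carr M). \<exists>q. tdist M c b < v \<and> realizes M (?p k q) c"
    if b: "b \<in> lists (carr M)" "tdist M b a < u" and v: "0 < v" for b v k
  proof -
    let ?V = "tuple_ball M b v \<inter> tuple_ball M a u"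
    note V = test_tuple_open[OF a(1) b(1) u v b(2)]
    have resV: "residual_on T ?V (\<Union>l. S k l)" using res by (rule residual_on_mono) auto
    \<comment> \<open>A set and its complement cannot both be residual on a nonempty open set, by
      Baire; so some piece is residual on a smaller open set.\<close>
    have "\<not> residual_on T ?V (- (\<Union>l. S k l))"
    proof
      assume neg: "residual_on T ?V (- (\<Union>l. S k l))"
      have "residual_on T ?V (\<Inter>m::nat. if m = 0 then \<Union>l. S k l else - (\<Union>l. S k l))"
        using resV neg by (intro residual_on_INT) auto
      moreover have "(\<Inter>m::nat. if m = 0 then \<Union>l. S k l else - (\<Union>l. S k l)) = {}"
        by (auto split: if_splits dest: spec[of _ 0] spec[of _ 1])
      ultimately show False using residual_on_nonempty[OF completely_metrizable_T V] by fastforce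
    qed
    then obtain l W where W: "W \<subseteq> ?V" "openin T W" "W \<noteq> {}" "residual_on T W (S k l)"
      using locally_decided_UN_cases_T[of "S k" ?V] dec V(1) by blast
    then obtain y where y: "y \<in> W" by blast
    have yt: "y \<in> tail_dense M" using openin_T_carr[OF W(2) y] .
    obtain m e where e: "m \<ge> n" "0 < e" "tuple_ball M (map y [0..<m]) e \<subseteq> W"
      using openin_T_tuple_ball_subset[OF W(2) y] by metis
    obtain i where i: "m = n + i" using e(1) le_Suc_ex by blast
    \<comment> \<open>Fits a ball of one of the allowed radii \<open>u / (j + 1)\<close> into
      \<open>W\<close>.\<close>
    obtain j where "inverse (real (Suc j)) < e / u" using e(2) u reals_Archimedean[of "e / u"] by auto
    then have "u / real (Suc j) < e" using u by (simp add: field_simps)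
    then have "tuple_ball M (map y [0..<m]) (u / real (Suc j)) \<subseteq> W"
      using e(3) by (fastforce simp: tuple_ball_def)
    then have "residual_on T (tuple_ball M (map y [0..<m]) (u / real (Suc j))) (S k l)"
      using W(4) by (auto intro: residual_on_mono)
    then have "realizes M (?p k (prod_encode (l, prod_encode (i, j)))) (map y [0..<m])"
      using p[OF map_in_lists[OF yt], of m i k l j] i by simp
    then show ?thesis
      using map_in_lists[OF yt] tdist_map_less[OF _ v, of y b] y W(1) by blast
  qed
  then show "realizes M (Block n u ?p) a" using a(2) by simp
next
  assume real: "realizes M (Block n u ?p) a"
  show "residual_on T (tuple_ball M a u) (\<Inter>k. \<Union>l. S k l)"
  proof (intro residual_on_INT residual_on_local_T)
    fix k W assume W: "openin T W" "W \<noteq> {}" "W \<subseteq> tuple_ball M a u"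
    then obtain y where y: "y \<in> W" by blast
    obtain m e where e: "0 < e" "tuple_ball M (map y [0..<m]) e \<subseteq> W"
      using openin_T_tuple_ball_subset[OF W(1) y] by metis
    have b: "map y [0..<m] \<in> lists (carr M)" using openin_T_carr[OF W(1) y] by (rule map_in_lists)
    moreover have "tdist M (map y [0..<m]) a < u" using W(3) y u by (intro tdist_map_less) auto
    ultimately obtain c q where c: "c \<in> lists (carr M)" "tdist M c (map y [0..<m]) < e" "realizes M (?p k q) c"
      using real e(1) by fastforce
    obtain l i j where q: "prod_decode q = (l, prod_encode (i, j))"
      by (metis old.prod.exhaust prod_decode_inverse)
    have "realizes M (p k l i j) c" using c(3) by (simp add: q)
    moreover from this have "length c = n + i" using realizes_length len by metis
    ultimately have res: "residual_on T (tuple_ball M c (u / real (Suc j))) (S k l)"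
      using p c(1) by blast
    \<comment> \<open>The ball about \<open>c\<close>, on which \<open>S k l\<close> is residual,
      meets the neighbourhood of \<open>y\<close> inside \<open>W\<close>; localization asks for
      such an open set in every \<open>W\<close>.\<close>
    let ?W = "tuple_ball M c (u / real (Suc j)) \<inter> tuple_ball M (map y [0..<m]) e"
    have "0 < u / real (Suc j)" using u by simp
    then have "?W \<noteq> {}" using tuple_ball_overwrite_append[OF c(1) b e(1) _ c(2)] by blast
    moreover have "openin T ?W" using openin_tuple_ball b c(1) by blast
    moreover have "residual_on T ?W (\<Union>l. S k l)" using res by (rule residual_on_mono) auto
    ultimately show "\<exists>W'\<subseteq>W. openin T W' \<and> W' \<noteq> {} \<and> residual_on T W' (\<Union>l. S k l)"
      using e(2) by (intro exI[of _ ?W]) auto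
  qed
qed

text \<open>Baire's theorem on \<open>V \<inter> O'\<close>: were it nonempty, it would contain a
  point outside \<open>O'\<close>.\<close>

lemma residual_on_closed_iff:
  assumes V: "openin T V" and O: "openin T O'"
  shows "residual_on T V (tail_dense M - O') \<longleftrightarrow> V \<inter> O' = {}"
proof
  assume res: "residual_on T V (tail_dense M - O')"
  show "V \<inter> O' = {}"
  proof (rule ccontr)
    assume "V \<inter> O' \<noteq> {}"
    moreover have "residual_on T (V \<inter> O') (tail_dense M - O')" using res by (rule residual_on_mono) auto
    ultimately show False
      using residual_on_nonempty[OF completely_metrizable_T openin_Int[OF V O]] by blast
  qed
next
  assume "V \<inter> O' = {}"
  then show "residual_on T V (tail_dense M - O')"
    using V openin_T_carr[OF V] by (intro residual_on_open) auto
qed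

end

text \<open>\<open>ball_sup \<psi> m n u\<close> is the formula
  \<open>sup\<^sub>y\<^sub>0\<^sub>,\<^sub>\<dots>\<^sub>,\<^sub>y\<^sub>m\<^sub>-\<^sub>1 min (max (- \<psi>(y)) 0) (min\<^sub>i\<^sub><\<^sub>n max (u - d(y\<^sub>i, x\<^sub>i)) 0)\<close>; it vanishes at \<open>x\<close> iff
  \<open>\<psi> \<ge> 0\<close> on the open ball of radius \<open>u\<close> about \<open>x\<close>.\<close>

definition Mini :: "fm \<Rightarrow> fm \<Rightarrow> fm" where
  "Mini \<phi> \<psi> = Scale (- 1) (Maxi (Scale (- 1) \<phi>) (Scale (- 1) \<psi>))"

definition Pos :: "fm \<Rightarrow> fm" where
  "Pos \<phi> = Maxi \<phi> (Scale 0 Unit)"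

text \<open>Under \<open>m\<close> quantifiers the bound \<open>y_j\<close> is index
  \<open>j\<close> and the free \<open>x_i\<close> is index \<open>m + i\<close>. \<open>Pos\<close>
  makes every term nonnegative, so the minimum is positive exactly if all terms are.\<close>

definition ball_body :: "fm \<Rightarrow> nat \<Rightarrow> nat list \<Rightarrow> rat \<Rightarrow> fm" where
  "ball_body \<psi> m is u = foldr (\<lambda>i. Mini (Pos (Plus (Scale u Unit) (Scale (- 1) (Atom 0 [i, m + i]))))) is
     (Pos (Scale (- 1) \<psi>))"

definition ball_sup :: "fm \<Rightarrow> nat \<Rightarrow> nat \<Rightarrow> rat \<Rightarrow> fm" where
  "ball_sup \<psi> m n u = (Var_sup ^^ m) (ball_body \<psi> m [0..<n] u)"

lemma eval_Mini: "eval M (Mini \<phi> \<psi>) e = min (eval M \<phi> e) (eval M \<psi> e)"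
  by (simp add: Mini_def min_def max_def)

lemma eval_Pos: "eval M (Pos \<phi>) e = max (eval M \<phi> e) 0"
  by (simp add: Pos_def)

lemma eval_ball_body:
  shows "0 \<le> eval M (ball_body \<psi> m is u) e"
    and "0 < eval M (ball_body \<psi> m is u) e \<longleftrightarrow>
      eval M \<psi> e < 0 \<and> (\<forall>i\<in>set is. interp M 0 [e i, e (m + i)] < of_rat u)"
  by (induction "is") (auto simp: ball_body_def eval_Mini eval_Pos)

lemma fv_ball_body: "fv (ball_body \<psi> m is u) = fv \<psi> \<union> set is \<union> (+) m ` set is"
  by (induction "is") (auto simp: ball_body_def Mini_def Pos_def)

lemma fv_funpow_Var_sup: "fv ((Var_sup ^^ m) \<phi>) = {i. m + i \<in> fv \<phi>}"
  by (induction m) auto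

lemma (in fragment) ball_sup_in_F:
  assumes "\<psi> \<in> F" shows "ball_body \<psi> m is u \<in> F" "ball_sup \<psi> m n u \<in> F"
proof -
  show *: "ball_body \<psi> m is u \<in> F" for "is"
    by (induction "is") (auto simp: ball_body_def Mini_def Pos_def assms dist_in_F)
  have "(Var_sup ^^ k) \<phi> \<in> F" if "\<phi> \<in> F" for k \<phi> using that by (induction k) auto
  then show "ball_sup \<psi> m n u \<in> F" using * by (simp add: ball_sup_def)
qed

text \<open>The assignment seen below \<open>length xs\<close> quantifiers; unlike
  \<open>overwrite\<close> it shifts \<open>e\<close> instead of replacing entries.\<close>

definition prepend :: "'a list \<Rightarrow> (nat \<Rightarrow> 'a) \<Rightarrow> nat \<Rightarrow> 'a" where
  "prepend xs e i = (if i < length xs then xs ! i else e (i - length xs))"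

context separable_structure
begin

lemma prepend_carr:
  "xs \<in> lists (carr M) \<Longrightarrow> range e \<subseteq> carr M \<Longrightarrow> range (prepend xs e) \<subseteq> carr M"
  by (auto simp: prepend_def image_subset_iff in_lists_conv_set)

text \<open>A bounded supremum of nonnegative values vanishes iff all of them do. The induction
  strips the innermost quantifier, so \<open>\<phi>\<close> varies.\<close>

lemma eval_funpow_Var_sup_eq_0:
  assumes "\<phi> \<in> formulas L" "\<And>e. range e \<subseteq> carr M \<Longrightarrow> 0 \<le> eval M \<phi> e" "range e \<subseteq> carr M"
  shows "eval M ((Var_sup ^^ m) \<phi>) e = 0 \<longleftrightarrow>
    (\<forall>xs\<in>lists (carr M). length xs = m \<longrightarrow> eval M \<phi> (prepend xs e) = 0)"
  using assms(1,2)
proof (induction m arbitrary: \<phi>)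
  case 0
  have "prepend [] e = e" by (auto simp: prepend_def)
  then show ?case by auto
next
  case (Suc m)
  obtain b where b: "bounded_in M \<phi> b" using formula_bounded[OF Suc.prems(1)] by blast
  have le: "eval M \<phi> (case_nat x e') \<le> eval M (Var_sup \<phi>) e'" if "range e' \<subseteq> carr M" "x \<in> carr M" for e' x
    unfolding eval.simps using that by (intro cSUP_upper bdd_image_Var(1)[OF b])
  have nonneg: "0 \<le> eval M (Var_sup \<phi>) e'" if e': "range e' \<subseteq> carr M" for e'
  proof -
    obtain x where x: "x \<in> carr M" using carr_nonempty by blast
    show ?thesis using Suc.prems(2)[OF case_nat_carr[OF e' x]] le[OF e' x] by linarith
  qed
  have sup: "eval M (Var_sup \<phi>) e' = 0 \<longleftrightarrow> (\<forall>x\<in>carr M. eval M \<phi> (case_nat x e') = 0)"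
    if e': "range e' \<subseteq> carr M" for e'
  proof
    assume "eval M (Var_sup \<phi>) e' = 0"
    then show "\<forall>x\<in>carr M. eval M \<phi> (case_nat x e') = 0"
      using le[OF e'] Suc.prems(2)[OF case_nat_carr[OF e']] by (metis antisym)
  next
    assume "\<forall>x\<in>carr M. eval M \<phi> (case_nat x e') = 0"
    then show "eval M (Var_sup \<phi>) e' = 0" using carr_nonempty by simp
  qed
  have pre: "case_nat x (prepend xs e) = prepend (x # xs) e" for x xs
    by (auto simp: prepend_def fun_eq_iff split: nat.split)
  have "eval M ((Var_sup ^^ Suc m) \<phi>) e = 0 \<longleftrightarrow>
      (\<forall>xs\<in>lists (carr M). length xs = m \<longrightarrow> eval M (Var_sup \<phi>) (prepend xs e) = 0)"
    unfolding funpow_Suc_right comp_def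
    by (rule Suc.IH[OF formulas.intros(6)[OF Suc.prems(1)] nonneg])
  also have "\<dots> \<longleftrightarrow> (\<forall>xs\<in>lists (carr M). length xs = m \<longrightarrow>
      (\<forall>x\<in>carr M. eval M \<phi> (prepend (x # xs) e) = 0))"
    using sup[OF prepend_carr[OF _ assms(3)]] unfolding pre by blast
  also have "\<dots> \<longleftrightarrow> (\<forall>xs\<in>lists (carr M). length xs = Suc m \<longrightarrow> eval M \<phi> (prepend xs e) = 0)"
  proof (intro iffI ballI impI)
    fix xs assume "\<forall>xs\<in>lists (carr M). length xs = m \<longrightarrow> (\<forall>x\<in>carr M. eval M \<phi> (prepend (x # xs) e) = 0)"
      and "xs \<in> lists (carr M)" "length xs = Suc m"
    then show "eval M \<phi> (prepend xs e) = 0" by (cases xs) auto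
  next
    fix xs x assume *: "\<forall>xs\<in>lists (carr M). length xs = Suc m \<longrightarrow> eval M \<phi> (prepend xs e) = 0"
      and "xs \<in> lists (carr M)" "length xs = m" "x \<in> carr M"
    then show "eval M \<phi> (prepend (x # xs) e) = 0" using bspec[OF *, of "x # xs"] by simp
  qed
  finally show ?case .
qed

end

context fragment_structure
begin

text \<open>Membership in the ball and the sign of \<open>\<psi>\<close> depend on the first
  \<open>m\<close> entries of a sequence only, so quantifying over \<open>m\<close>-tuples amounts
  to quantifying over \<open>D(M)\<close>.\<close>

lemma evalt_ball_sup_eq_0:
  assumes \<psi>: "\<psi> \<in> F" and m: "fv \<psi> \<subseteq> {..<m}" "n \<le> m"
    and c: "c \<in> lists (carr M)" "length c = n" and u: "0 < u"
  shows "evalt M (ball_sup \<psi> m n u) c = 0 \<longleftrightarrow>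
    tuple_ball M c (of_rat u) \<inter> {y \<in> tail_dense M. eval M \<psi> y < 0} = {}"
proof -
  let ?e = "overwrite c y0" and ?b = "ball_body \<psi> m [0..<n] u"
  have e: "range ?e \<subseteq> carr M"
    using tail_dense_carr[OF overwrite_tail_dense[OF c(1) y0]] by auto
  have b: "?b \<in> formulas L" using ball_sup_in_F(1)[OF \<psi>] by (rule F_formulas)
  have "fv (ball_sup \<psi> m n u) \<subseteq> {..<length c}"
    using m c(2) by (auto simp: ball_sup_def fv_funpow_Var_sup fv_ball_body)
  then have "evalt M (ball_sup \<psi> m n u) c = eval M ((Var_sup ^^ m) ?b) ?e"
    unfolding ball_sup_def[symmetric] by (intro evalt_eq_eval) (auto simp: overwrite_def)
  also have "\<dots> = 0 \<longleftrightarrow> (\<forall>xs\<in>lists (carr M). length xs = m \<longrightarrow> eval M ?b (prepend xs ?e) = 0)"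
    by (rule eval_funpow_Var_sup_eq_0[OF b eval_ball_body(1) e])
  also have "\<dots> \<longleftrightarrow> (\<forall>xs\<in>lists (carr M). length xs = m \<longrightarrow>
      \<not> (overwrite xs y0 \<in> tuple_ball M c (of_rat u) \<and> eval M \<psi> (overwrite xs y0) < 0))"
  proof (intro ball_cong refl imp_cong)
    fix xs assume xs: "xs \<in> lists (carr M)" "length xs = m"
    have "eval M ?b (prepend xs ?e) = 0 \<longleftrightarrow> \<not> 0 < eval M ?b (prepend xs ?e)"
      using eval_ball_body(1)[of M \<psi> m "[0..<n]" u "prepend xs ?e"] by linarith
    moreover have "eval M \<psi> (prepend xs ?e) = eval M \<psi> (overwrite xs y0)"
      using m(1) xs(2) by (intro eval_cong_fv) (auto simp: prepend_def overwrite_def)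
    moreover have "interp M 0 [prepend xs ?e i, prepend xs ?e (m + i)] = sdist M (overwrite xs y0 i) (c ! i)"
      if "i < n" for i
      using that m(2) c xs by (auto simp: prepend_def overwrite_def sdist_def in_lists_conv_set)
    ultimately show "eval M ?b (prepend xs ?e) = 0 \<longleftrightarrow>
        \<not> (overwrite xs y0 \<in> tuple_ball M c (of_rat u) \<and> eval M \<psi> (overwrite xs y0) < 0)"
      unfolding eval_ball_body(2) using overwrite_tail_dense[OF xs(1) y0] c(2)
      by (auto simp: tuple_ball_def)
  qed
  also have "\<dots> \<longleftrightarrow> tuple_ball M c (of_rat u) \<inter> {y \<in> tail_dense M. eval M \<psi> y < 0} = {}"
  proof
    assume *: "\<forall>xs\<in>lists (carr M). length xs = m \<longrightarrow>
      \<not> (overwrite xs y0 \<in> tuple_ball M c (of_rat u) \<and> eval M \<psi> (overwrite xs y0) < 0)"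
    have False if y: "y \<in> tuple_ball M c (of_rat u)" "eval M \<psi> y < 0" for y
    proof -
      have yt: "y \<in> tail_dense M" using y(1) by (simp add: tuple_ball_def)
      let ?xs = "map y [0..<m]"
      have xs: "?xs \<in> lists (carr M)" using map_in_lists[OF yt] .
      have "eval M \<psi> (overwrite ?xs y0) = eval M \<psi> y"
        using m(1) by (intro eval_cong_fv) (auto simp: overwrite_def)
      moreover have "overwrite ?xs y0 \<in> tuple_ball M c (of_rat u)"
        using y(1) c(2) m(2) overwrite_tail_dense[OF xs y0] by (auto simp: tuple_ball_def overwrite_def)
      ultimately show False using bspec[OF * xs] y(2) by simp
    qed
    then show "tuple_ball M c (of_rat u) \<inter> {y \<in> tail_dense M. eval M \<psi> y < 0} = {}" by auto
  qed (use overwrite_tail_dense y0 in auto)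
  finally show ?thesis .
qed

end

section \<open>Borel sets and families\<close>

context fragment
begin

text \<open>The bound on \<open>ae_rad P\<close> lets \<open>P\<close> be a member of a block of
  radius \<open>w\<close>. Radii are rational because they enter formulas as coefficients; all
  lengths are covered because members of a block may have more variables.\<close>

definition represented :: "omega1 \<Rightarrow> code set \<Rightarrow> bool" where
  "represented \<alpha> A \<longleftrightarrow> (\<forall>n w. 0 < w \<longrightarrow> (\<exists>P. ae_family L F (Some \<alpha>) P \<and> ae_len P = n \<and> ae_rad P \<le> of_rat w \<and>
     (\<forall>M y0 c. separable_structure L M y0 \<longrightarrow> c \<in> lists (carr M) \<longrightarrow> length c = n \<longrightarrow>
        (residual_on (tail_dense_topology M) (tuple_ball M c (of_rat w)) (coded_in L M A) \<longleftrightarrow> realizes M P c))))"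

lemma fragment_structure: "separable_structure L M y0 \<Longrightarrow> fragment_structure L F M y0"
  by (simp add: fragment_structure_def fragment_axioms)

lemma represented_closed:
  assumes "Pi0 (t_top L F) 1 A"
  shows "represented 0 A"
  unfolding represented_def
proof (intro allI impI)
  fix n and w :: rat assume w: "0 < w"
  obtain U where U: "Sigma0 (t_top L F) 1 U" "A = Mod L - U"
    using assms by cases (auto simp: topspace_t_top)
  have "openin (t_top L F) U" using U(1) by cases auto
  then obtain \<psi> :: "nat \<Rightarrow> fm" where \<psi>: "\<And>k. \<psi> k \<in> F" "U = (\<Union>k. neg_set L (\<psi> k))"
    by (rule open_countable_neg_sets) auto
  \<comment> \<open>With \<open>m \<ge> n\<close> every \<open>x_i\<close> has a bound counterpart
    \<open>y_i\<close> to be compared with.\<close>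
  have "\<forall>k. \<exists>m\<ge>n. fv (\<psi> k) \<subseteq> {..<m}"
  proof
    fix k
    obtain m where "fv (\<psi> k) \<subseteq> {..<m}" using fv_bounded[OF F_formulas[OF \<psi>(1)]] by blast
    then show "\<exists>m\<ge>n. fv (\<psi> k) \<subseteq> {..<m}" by (intro exI[of _ "max n m"]) auto
  qed
  then obtain m where m: "\<And>k. n \<le> m k" "\<And>k. fv (\<psi> k) \<subseteq> {..<m k}" by metis
  let ?p = "\<lambda>k. Basic n (ball_sup (\<psi> k) (m k) n w)"
  have "fv (ball_sup (\<psi> k) (m k) n w) \<subseteq> {..<n}" for k
    using m[of k] by (auto simp: ball_sup_def fv_funpow_Var_sup fv_ball_body)
  then have "ae_family L F None (?p k)" for k
    using ball_sup_in_F(2)[OF \<psi>(1)] by (intro ae_family.basic)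
  then have fam: "ae_family L F (Some 0) (Meet n 0 ?p)"
    by (intro ae_family.zero) (auto intro: exI[of _ None])
  have "residual_on (tail_dense_topology M) (tuple_ball M c (of_rat w)) (coded_in L M A) \<longleftrightarrow>
      realizes M (Meet n 0 ?p) c"
    if M: "separable_structure L M y0" and c: "c \<in> lists (carr M)" "length c = n" for M y0 c
  proof -
    interpret fragment_structure L F M y0 using M by (rule fragment_structure)
    have "residual_on T (tuple_ball M c (of_rat w)) (coded_in L M A) \<longleftrightarrow>
        tuple_ball M c (of_rat w) \<inter> coded_in L M U = {}"
      unfolding U(2) coded_in_diff
      using openin_coded_in[OF \<open>openin (t_top L F) U\<close>] openin_tuple_ball[OF c(1)]
      by (intro residual_on_closed_iff)
    also have "\<dots> \<longleftrightarrow> (\<forall>k. tuple_ball M c (of_rat w) \<inter> {y \<in> tail_dense M. eval M (\<psi> k) y < 0} = {})"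
      unfolding \<psi>(2) coded_in_UN coded_in_neg_set[OF F_formulas[OF \<psi>(1)]] by blast
    also have "\<dots> \<longleftrightarrow> realizes M (Meet n 0 ?p) c"
      using evalt_ball_sup_eq_0[OF \<psi>(1) m(2) m(1) c w] c(2) by simp
    finally show ?thesis .
  qed
  then show "\<exists>P. ae_family L F (Some 0) P \<and> ae_len P = n \<and> ae_rad P \<le> of_rat w \<and>
     (\<forall>M y0 c. separable_structure L M y0 \<longrightarrow> c \<in> lists (carr M) \<longrightarrow> length c = n \<longrightarrow>
        (residual_on (tail_dense_topology M) (tuple_ball M c (of_rat w)) (coded_in L M A) \<longleftrightarrow> realizes M P c))"
    using fam w by (intro exI[of _ "Meet n 0 ?p"]) auto
qed

text \<open>A block of rank 1 admits members of rank -1 only, so its pieces must be zero sets of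
  single formulas instead of sets represented at rank 0.\<close>

lemma represented_one:
  fixes B :: "nat \<Rightarrow> code set"
  assumes B: "\<And>k. openin (t_top L F) (B k)" and A: "A = (\<Inter>k. B k)"
  shows "represented (osuc 0) A"
  unfolding represented_def
proof (intro allI impI)
  fix n and w :: rat assume w: "0 < w"
  have "\<forall>k. \<exists>\<psi>. (\<forall>l::nat. \<psi> l \<in> F) \<and> B k = (\<Union>l. zero_set L (\<psi> l))"
    using open_countable_zero_sets[OF B] by metis
  from choice[OF this] obtain \<psi> :: "nat \<Rightarrow> nat \<Rightarrow> fm"
    where "\<forall>k. (\<forall>l. \<psi> k l \<in> F) \<and> B k = (\<Union>l. zero_set L (\<psi> k l))" ..
  then have \<psi>: "\<And>k l. \<psi> k l \<in> F" "\<And>k. B k = (\<Union>l. zero_set L (\<psi> k l))" by blast+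
  let ?p = "\<lambda>k q. case prod_decode q of (l, i) \<Rightarrow>
      Basic (n + i) (if fv (\<psi> k l) \<subseteq> {..<n + i} then \<psi> k l else Unit)"
  have p: "n \<le> ae_len (?p k q) \<and> ae_rad (?p k q) \<le> of_rat w \<and> ae_family L F None (?p k q)" for k q
    using \<psi>(1) w by (cases "prod_decode q") (auto intro!: ae_family.basic)
  have fam: "ae_family L F (Some (osuc 0)) (Block n (of_rat w) ?p)"
    using p w by (intro ae_family.succ1) (auto intro: exI[of _ None])
  have "residual_on (tail_dense_topology M) (tuple_ball M c (of_rat w)) (coded_in L M A) \<longleftrightarrow>
      realizes M (Block n (of_rat w) ?p) c"
    if M: "separable_structure L M y0" and c: "c \<in> lists (carr M)" "length c = n" for M y0 c
  proof -
    interpret fragment_structure L F M y0 using M by (rule fragment_structure)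
    have "coded_in L M (B k) = (\<Union>l. {y \<in> tail_dense M. eval M (\<psi> k l) y = 0})" for k
      unfolding \<psi>(2) coded_in_UN coded_in_zero_set[OF F_formulas[OF \<psi>(1)]] ..
    then show ?thesis
      unfolding A coded_in_INT using w
      by (intro realizes_Block_Basic_iff c openin_coded_in B F_formulas \<psi>(1)) auto
  qed
  then show "\<exists>P. ae_family L F (Some (osuc 0)) P \<and> ae_len P = n \<and> ae_rad P \<le> of_rat w \<and>
     (\<forall>M y0 c. separable_structure L M y0 \<longrightarrow> c \<in> lists (carr M) \<longrightarrow> length c = n \<longrightarrow>
        (residual_on (tail_dense_topology M) (tuple_ball M c (of_rat w)) (coded_in L M A) \<longleftrightarrow> realizes M P c))"
    using fam by (intro exI[of _ "Block n (of_rat w) ?p"]) auto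
qed

lemma represented_limit:
  fixes B :: "nat \<Rightarrow> code set"
  assumes \<alpha>: "is_limit \<alpha>" and B: "\<And>k. \<exists>\<gamma><\<alpha>. represented \<gamma> (B k)" and A: "A = (\<Inter>k. B k)"
  shows "represented \<alpha> A"
  unfolding represented_def
proof (intro allI impI)
  fix n and w :: rat assume w: "0 < w"
  have "\<forall>k. \<exists>P. (\<exists>\<gamma><\<alpha>. ae_family L F (Some \<gamma>) P) \<and> ae_len P = n \<and> ae_rad P \<le> of_rat w \<and>
     (\<forall>M y0 c. separable_structure L M y0 \<longrightarrow> c \<in> lists (carr M) \<longrightarrow> length c = n \<longrightarrow>
        (residual_on (tail_dense_topology M) (tuple_ball M c (of_rat w)) (coded_in L M (B k)) \<longleftrightarrow> realizes M P c))"
    using B w unfolding represented_def by meson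
  from choice[OF this] obtain p where p:
      "\<And>k. \<exists>\<gamma><\<alpha>. ae_family L F (Some \<gamma>) (p k)" "\<And>k. ae_len (p k) = n" "\<And>k. ae_rad (p k) \<le> of_rat w"
      "\<And>k M y0 c. separable_structure L M y0 \<Longrightarrow> c \<in> lists (carr M) \<Longrightarrow> length c = n \<Longrightarrow>
        residual_on (tail_dense_topology M) (tuple_ball M c (of_rat w)) (coded_in L M (B k)) \<longleftrightarrow> realizes M (p k) c"
    by blast
  have "\<exists>\<gamma>. rank_less \<gamma> \<alpha> \<and> ae_family L F \<gamma> (p k)" for k
    using p(1)[of k] by (metis rank_less.simps(2))
  then have fam: "ae_family L F (Some \<alpha>) (Meet n (of_rat w) p)"
    using p(2,3) w \<alpha> by (intro ae_family.limit) auto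
  have "residual_on (tail_dense_topology M) (tuple_ball M c (of_rat w)) (coded_in L M A) \<longleftrightarrow>
      realizes M (Meet n (of_rat w) p) c"
    if M: "separable_structure L M y0" and c: "c \<in> lists (carr M)" "length c = n" for M y0 c
  proof -
    interpret fragment_structure L F M y0 using M by (rule fragment_structure)
    have "residual_on T (tuple_ball M c (of_rat w)) (coded_in L M A) \<longleftrightarrow>
        (\<forall>k. residual_on T (tuple_ball M c (of_rat w)) (coded_in L M (B k)))"
      unfolding A coded_in_INT
    proof (intro iffI allI)
      fix k assume "residual_on T (tuple_ball M c (of_rat w)) (\<Inter>k. coded_in L M (B k))"
      then show "residual_on T (tuple_ball M c (of_rat w)) (coded_in L M (B k))"
        by (rule residual_on_mono) auto
    qed (simp add: residual_on_INT)
    then show ?thesis using p(4)[OF M c] c(2) by simp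
  qed
  then show "\<exists>P. ae_family L F (Some \<alpha>) P \<and> ae_len P = n \<and> ae_rad P \<le> of_rat w \<and>
     (\<forall>M y0 c. separable_structure L M y0 \<longrightarrow> c \<in> lists (carr M) \<longrightarrow> length c = n \<longrightarrow>
        (residual_on (tail_dense_topology M) (tuple_ball M c (of_rat w)) (coded_in L M A) \<longleftrightarrow> realizes M P c))"
    using fam p(2) by (intro exI[of _ "Meet n (of_rat w) p"]) auto
qed

text \<open>\<open>R\<close> describes the ranks allowed for members and so covers both kinds of
  successor: ranks below a limit \<open>\<beta>\<close> for \<open>\<alpha> = osuc \<beta>\<close>,
  and exactly \<open>\<beta>'\<close> for \<open>\<alpha> = osuc (osuc \<beta>')\<close>.\<close>

lemma represented_Block:
  fixes C :: "nat \<Rightarrow> nat \<Rightarrow> code set"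
  assumes C: "\<And>k l. \<exists>\<zeta>. Pi0 (t_top L F) \<zeta> (C k l)" "\<And>k l. \<exists>\<gamma>. R \<gamma> \<and> represented \<gamma> (C k l)"
    and A: "A = (\<Inter>k. \<Union>l. C k l)"
    and R: "\<And>n u p. 0 \<le> u \<Longrightarrow> (\<And>k l. n \<le> ae_len (p k l)) \<Longrightarrow> (\<And>k l. ae_rad (p k l) \<le> u) \<Longrightarrow>
      (\<And>k l. \<exists>\<gamma>. R \<gamma> \<and> ae_family L F (Some \<gamma>) (p k l)) \<Longrightarrow> ae_family L F (Some \<alpha>) (Block n u p)"
  shows "represented \<alpha> A"
  unfolding represented_def
proof (intro allI impI)
  fix n and w :: rat assume w: "0 < w"
  define Q where "Q k l i j P \<longleftrightarrow> (\<exists>\<gamma>. R \<gamma> \<and> ae_family L F (Some \<gamma>) P) \<and> ae_len P = n + i \<and>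
     ae_rad P \<le> of_rat w \<and>
     (\<forall>M y0 c. separable_structure L M y0 \<longrightarrow> c \<in> lists (carr M) \<longrightarrow> length c = n + i \<longrightarrow>
        (residual_on (tail_dense_topology M) (tuple_ball M c (of_rat w / real (Suc j))) (coded_in L M (C k l))
         \<longleftrightarrow> realizes M P c))" for k l i j P
  have ex: "\<exists>P. Q k l i j P" for k l i j
  proof -
    obtain \<gamma> where \<gamma>: "R \<gamma>" "represented \<gamma> (C k l)" using C(2) by blast
    have rat: "of_rat (w / of_nat (Suc j)) = (of_rat w / real (Suc j) :: real)"
      by (simp add: of_rat_divide del: of_nat_Suc)
    \<comment> \<open>The smaller radius is again rational, and a family for it has radius at most
      \<open>w\<close>.\<close>
    have "0 < w / of_nat (Suc j)" using w by (simp del: of_nat_Suc)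
    then obtain P where P: "ae_family L F (Some \<gamma>) P" "ae_len P = n + i" "ae_rad P \<le> of_rat w / real (Suc j)"
      "\<forall>M y0 c. separable_structure L M y0 \<longrightarrow> c \<in> lists (carr M) \<longrightarrow> length c = n + i \<longrightarrow>
        (residual_on (tail_dense_topology M) (tuple_ball M c (of_rat w / real (Suc j))) (coded_in L M (C k l))
         \<longleftrightarrow> realizes M P c)"
      using \<gamma>(2) unfolding represented_def rat[symmetric] by blast
    have "of_rat w / real (Suc j) \<le> (of_rat w :: real)" using w by (simp add: field_simps)
    then have "Q k l i j P" unfolding Q_def using P \<gamma>(1) by auto
    then show ?thesis ..
  qed
  define p where "p k l i j = (SOME P. Q k l i j P)" for k l i j
  have "Q k l i j (p k l i j)" for k l i j
    unfolding p_def by (rule someI_ex[OF ex])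
  then have p:
      "\<And>k l i j. \<exists>\<gamma>. R \<gamma> \<and> ae_family L F (Some \<gamma>) (p k l i j)"
      "\<And>k l i j. ae_len (p k l i j) = n + i" "\<And>k l i j. ae_rad (p k l i j) \<le> of_rat w"
      "\<And>k l i j M y0 c. separable_structure L M y0 \<Longrightarrow> c \<in> lists (carr M) \<Longrightarrow> length c = n + i \<Longrightarrow>
        residual_on (tail_dense_topology M) (tuple_ball M c (of_rat w / real (Suc j))) (coded_in L M (C k l))
         \<longleftrightarrow> realizes M (p k l i j) c"
    unfolding Q_def by blast+
  let ?p = "\<lambda>k q. case prod_decode q of (l, r) \<Rightarrow> case prod_decode r of (i, j) \<Rightarrow> p k l i j"
  have fam: "ae_family L F (Some \<alpha>) (Block n (of_rat w) ?p)"
    using p(1,2,3) w by (intro R) (auto split: prod.split)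
  have "residual_on (tail_dense_topology M) (tuple_ball M c (of_rat w)) (coded_in L M A) \<longleftrightarrow>
      realizes M (Block n (of_rat w) ?p) c"
    if M: "separable_structure L M y0" and c: "c \<in> lists (carr M)" "length c = n" for M y0 c
  proof -
    interpret fragment_structure L F M y0 using M by (rule fragment_structure)
    have "locally_decided T (coded_in L M (C k l))" for k l
      using C(1) locally_decided_coded_in(2) by blast
    then show ?thesis
      unfolding A coded_in_INT coded_in_UN using w
      by (intro realizes_Block_iff c p(4)[OF M, symmetric] p(2)) auto
  qed
  then show "\<exists>P. ae_family L F (Some \<alpha>) P \<and> ae_len P = n \<and> ae_rad P \<le> of_rat w \<and>
     (\<forall>M y0 c. separable_structure L M y0 \<longrightarrow> c \<in> lists (carr M) \<longrightarrow> length c = n \<longrightarrow>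
        (residual_on (tail_dense_topology M) (tuple_ball M c (of_rat w)) (coded_in L M A) \<longleftrightarrow> realizes M P c))"
    using fam by (intro exI[of _ "Block n (of_rat w) ?p"]) auto
qed

text \<open>If \<open>\<beta>\<close> is \<open>m\<close> steps above zero or a limit, the new rank
  is \<open>m + 2\<close> steps above it, and \<open>succ2\<close> then asks for members
  \<open>m\<close> steps above it.\<close>

lemma ae_family_osuc_osuc:
  assumes "0 \<le> u" "\<And>k l. n \<le> ae_len (p k l)" "\<And>k l. ae_rad (p k l) \<le> u"
    "\<And>k l. ae_family L F (Some \<beta>) (p k l)"
  shows "ae_family L F (Some (osuc (osuc \<beta>))) (Block n u p)"
proof -
  obtain \<delta> m where \<delta>: "\<delta> = 0 \<or> is_limit \<delta>" "\<beta> = (osuc ^^ m) \<delta>" using omega1_limit_plus_nat by blast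
  have "ae_family L F (Some ((osuc ^^ Suc (Suc m)) \<delta>)) (Block n u p)"
    using assms \<delta> by (intro ae_family.succ2) auto
  then show ?thesis using \<delta>(2) by simp
qed

text \<open>For \<open>\<alpha> = osuc \<beta>\<close> with \<open>\<beta> > 0\<close> the factors
  have class at most \<open>1 + \<beta>\<close> and their pieces class below that. If
  \<open>\<beta>\<close> is a limit, the pieces get ranks below \<open>\<beta>\<close>; if
  \<open>\<beta> = osuc \<beta>'\<close>, all are lifted to class \<open>1 + \<beta>'\<close>,
  because \<open>succ2\<close> prescribes the rank of its members exactly.\<close>

lemma represented_Pi0: "Pi0 (t_top L F) (1 + \<alpha>) A \<Longrightarrow> represented \<alpha> A"
proof (induction \<alpha> arbitrary: A rule: less_induct)
  case (less \<alpha>)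
  show ?case
  proof (cases "\<alpha> = 0")
    case True
    then show ?thesis using less.prems represented_closed by (simp add: oadd_zero)
  next
    case False
    then have "0 < \<alpha>" using zero_le_omega1[of \<alpha>] by simp
    then have gt1: "1 < 1 + \<alpha>" using oadd_strict_mono[of 0 \<alpha> 1] by (simp add: oadd_zero)
    obtain \<zeta> B where B: "\<And>n::nat. 1 \<le> \<zeta> n" "\<And>n. \<zeta> n < 1 + \<alpha>"
        "\<And>n. Sigma0 (t_top L F) (\<zeta> n) (B n)" "A = (\<Inter>n. B n)"
      using Pi0_as_Inter[OF less.prems gt1] by metis
    show ?thesis
    proof (cases \<alpha> rule: omega1_cases)
      case 2
      show ?thesis
      proof (rule represented_limit[OF 2 _ B(4)])
        fix k
        have "\<zeta> k < \<alpha>" using B(2)[of k] by (simp add: one_oadd_limit[OF 2])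
        \<comment> \<open>Passing from Sigma to Pi costs one level, which a limit absorbs.\<close>
        then have lt: "osuc (\<zeta> k) < \<alpha>" using 2 by (simp add: is_limit_def)
        have "1 \<le> osuc (\<zeta> k)" using B(1)[of k] osuc_greater[of "\<zeta> k"] by simp
        then obtain \<gamma> where \<gamma>: "\<gamma> \<le> osuc (\<zeta> k)" "osuc (\<zeta> k) = 1 + \<gamma>" by (rule one_oadd_surj)
        have "Pi0 (t_top L F) (1 + \<gamma>) (B k)" 
          using Sigma0_imp_Pi0_osuc[OF B(3,1), of k] unfolding \<gamma>(2) .
        then show "\<exists>\<gamma><\<alpha>. represented \<gamma> (B k)" using less.IH \<gamma>(1) lt by (meson le_less_trans)
      qed
    next
      case (3 \<beta>)
      have \<zeta>: "\<zeta> k \<le> 1 + \<beta>" for k using B(2)[of k] by (simp add: 3 oadd_osuc less_osuc_iff)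
      show ?thesis
      proof (cases "\<beta> = 0")
        case True
        \<comment> \<open>Here \<open>1 + \<beta>\<close> is 1, so every factor has class 1 and is
          open.\<close>
        have "openin (t_top L F) (B k)" for k
        proof -
          have "\<zeta> k = 1" using \<zeta>[of k] B(1)[of k] by (simp add: True oadd_zero)
          then show ?thesis using B(3)[of k] by (auto elim: Sigma0.cases)
        qed
        then show ?thesis unfolding 3 True using B(4) by (rule represented_one)
      next
        case False
        then have "0 < \<beta>" using zero_le_omega1[of \<beta>] by simp
        then have gt1': "1 < 1 + \<beta>" using oadd_strict_mono[of 0 \<beta> 1] by (simp add: oadd_zero)
        have "\<exists>\<theta> C. (\<forall>n::nat. 1 \<le> \<theta> n \<and> \<theta> n < 1 + \<beta> \<and> Pi0 (t_top L F) (\<theta> n) (C n)) \<and> B k = (\<Union>n. C n)" for k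
          using Sigma0_as_Union[OF B(3) \<zeta> gt1', of k] by metis
        then obtain \<theta> C where C: "\<And>k l::nat. 1 \<le> \<theta> k l" "\<And>k l. \<theta> k l < 1 + \<beta>"
            "\<And>k l. Pi0 (t_top L F) (\<theta> k l) (C k l)" "\<And>k. B k = (\<Union>l. C k l)"
          by metis
        have A: "A = (\<Inter>k. \<Union>l. C k l)" using B(4) C(4) by simp
        show ?thesis
        proof (cases \<beta> rule: omega1_cases)
          case 2
          have "\<exists>\<gamma><\<beta>. represented \<gamma> (C k l)" for k l
          proof -
            obtain \<gamma> where \<gamma>: "\<gamma> \<le> \<theta> k l" "\<theta> k l = 1 + \<gamma>" using C(1) by (rule one_oadd_surj)
            have "\<gamma> < \<beta>" using \<gamma>(1) C(2)[of k l] by (simp add: one_oadd_limit[OF 2])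
            moreover have "\<gamma> < \<alpha>" using \<open>\<gamma> < \<beta>\<close> 3 osuc_greater[of \<beta>] by simp
            ultimately show ?thesis using less.IH[of \<gamma>] C(3)[of k l] \<gamma>(2) by auto
          qed
          then show ?thesis
          proof (intro represented_Block[where C = C and R = "\<lambda>\<gamma>. \<gamma> < \<beta>"])
            fix n u and p :: "nat \<Rightarrow> nat \<Rightarrow> ae"
            assume p: "0 \<le> u" "\<And>k l. n \<le> ae_len (p k l)" "\<And>k l. ae_rad (p k l) \<le> u"
              "\<And>k l. \<exists>\<gamma><\<beta>. ae_family L F (Some \<gamma>) (p k l)"
            have "\<exists>\<gamma>. rank_less \<gamma> \<beta> \<and> ae_family L F \<gamma> (p k l)" for k l
              using p(4)[of k l] by (metis rank_less.simps(2))
            then show "ae_family L F (Some \<alpha>) (Block n u p)"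
              unfolding 3 using 2 p(1,2,3) by (intro ae_family.succ1) auto
          qed (use A C(3) in blast)+
        next
          case (3 \<beta>')
          have "represented \<beta>' (C k l)" for k l
          proof (rule less.IH)
            show "\<beta>' < \<alpha>" using 3 \<open>\<alpha> = osuc \<beta>\<close> osuc_greater[of \<beta>] osuc_greater[of \<beta>'] by simp
            have "\<theta> k l \<le> 1 + \<beta>'" using C(2)[of k l] by (simp add: 3 oadd_osuc less_osuc_iff)
            then show "Pi0 (t_top L F) (1 + \<beta>') (C k l)" by (rule Pi0_mono[OF C(3) _ C(1)])
          qed
          then show ?thesis
          proof (intro represented_Block[where C = C and R = "\<lambda>\<gamma>. \<gamma> = \<beta>'"])
            fix n u and p :: "nat \<Rightarrow> nat \<Rightarrow> ae"
            assume "0 \<le> u" "\<And>k l. n \<le> ae_len (p k l)" "\<And>k l. ae_rad (p k l) \<le> u"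
              "\<And>k l. \<exists>\<gamma>. \<gamma> = \<beta>' \<and> ae_family L F (Some \<gamma>) (p k l)"
            then show "ae_family L F (Some \<alpha>) (Block n u p)"
              unfolding \<open>\<alpha> = osuc \<beta>\<close> 3 by (intro ae_family_osuc_osuc) auto
          qed (use A C(3) in blast)+
        qed (use False in simp)
      qed
    qed (use False in simp)
  qed
qed

end

section \<open>Vaught transforms\<close>

theorem theorem3p2:
  fixes L :: signature and F :: "fm set" and \<alpha> :: omega1
    and A :: "code set" and a :: "nat list" and u :: rat
  assumes "is_signature L" and "is_fragment L F"
    and "1 \<le> \<alpha>"
    and "A \<subseteq> Mod L" and "Pi0 (t_top L F) (1 + \<alpha>) A"
    and "0 < u"
  shows "\<exists>P. ae_family L F (Some \<alpha>) P \<and> ae_len P = length a \<and>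
           vaught_star L A a u = {N \<in> Mod L. realizes (str L N) P (pts L N a)}"
proof -
  interpret fragment L F using assms(1,2) by unfold_locales
  have "represented \<alpha> A" using assms(5) by (rule represented_Pi0)
  then obtain P where P: "ae_family L F (Some \<alpha>) P" "ae_len P = length a"
      "\<And>M y0 c. separable_structure L M y0 \<Longrightarrow> c \<in> lists (carr M) \<Longrightarrow> length c = length a \<Longrightarrow>
        residual_on (tail_dense_topology M) (tuple_ball M c (of_rat u)) (coded_in L M A) \<longleftrightarrow> realizes M P c"
    using assms(6) unfolding represented_def by meson
  have "N \<in> vaught_star L A a u \<longleftrightarrow> realizes (str L N) P (pts L N a)" if N: "N \<in> Mod L" for N
  proof -
    let ?M = "str L N"
    interpret separable_structure L ?M "snd (pres L N)"
      using separable_structure_str[OF assms(1) N] .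
    have c: "pts L N a \<in> lists (carr ?M)" "length (pts L N a) = length a"
      using tail_dense_carr[OF y0] by (auto simp: pts_def)
    \<comment> \<open>Positivity of \<open>u\<close> identifies the neighbourhood of
      \<open>vaught_star\<close>, given by \<open>tdist\<close>, with the entrywise ball.\<close>
    have U: "{y \<in> tail_dense ?M. tdist ?M (map y [0..<length a]) (pts L N a) < of_rat u} =
        tuple_ball ?M (pts L N a) (of_rat u)" (is "?U = _")
      using assms(6) c(2) by (auto simp: tuple_ball_def tdist_less_iff)
    have "{y \<in> tuple_ball ?M (pts L N a) (of_rat u). code_of L ?M y \<in> A} =
        tuple_ball ?M (pts L N a) (of_rat u) \<inter> coded_in L ?M A"
      by (auto simp: coded_in_def tuple_ball_def)
    moreover have "N \<in> vaught_star L A a u \<longleftrightarrow>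
        comeager_in (subtopology T ?U) {y \<in> ?U. code_of L ?M y \<in> A}"
      using N by (simp add: vaught_star_def Let_def)
    ultimately have "N \<in> vaught_star L A a u \<longleftrightarrow>
        residual_on T (tuple_ball ?M (pts L N a) (of_rat u)) (coded_in L ?M A)"
      unfolding U using comeager_in_iff_residual_on[OF openin_tuple_ball[OF c(1)]] by simp
    then show ?thesis using P(3)[OF separable_structure_axioms c] by simp
  qed
  moreover have "vaught_star L A a u \<subseteq> Mod L" by (auto simp: vaught_star_def)
  ultimately show ?thesis using P(1,2) by (intro exI[of _ P]) auto
qed

end
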